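(* Let $G$ be a finite group and let $S=\{g_1,\dots,g_n\}$ be a set of generators of $G$ (with $g_1,\dots,g_n$ distinct). Then the group of homotopy classes of self-homotopy equivalences of the finite space $X(G,S)$ (constructed in the context) is isomorphic to $G$.
   Context: **Finite spaces and posets.** A finite space is a topological space with finitely many points. Finite $T_0$ spaces are identified with finite posets: for a finite $T_0$ space $X$ and $x\in X$, let $U_x$ be the intersection of all open sets containing $x$, and put $x\le y$ iff $U_x\subseteq U_y$. Conversely, a finite poset carries the topology whose open sets are the down-closed subsets. The level of $x$ in a finite poset is the largest $m$ such that there is a chain $x_1<\dots<x_m=x$. The group of homotopy classes of self-homotopy equivalences of a space $X$ is the set of (free) homotopy classes of homotopy equivalences $X\to X$, with group operation induced by composition. **The posets $F_k$.** For each integer $k\ge 0$, $F_k$ is the finite poset (equivalently finite $T_0$ space) on $2k+8$ points, determined up to isomorphism by the following conditions on its Hasse diagram, where the degree of a vertex is the number of Hasse diagram edges at that vertex, and every edge joins a point of the first (lower) level to a point of the second (upper) level, the lower point being smaller than the upper one: 1. The Hasse diagram has two levels, each with $k+4$ vertices. 2. On each level there are exactly two vertices of degree $2$ and, for each $i\in\{3,\dots,k+4\}$, exactly one vertex of degree $i$. 3. On each level, one of the two vertices of degree $2$ is connected to one vertex of degree $2$ on the other level and to the vertex of degree $k+4$ on the other level. 4. On each level, the other vertex of degree $2$ is connected to the vertices of degree $k+3$ and $k+4$ on the other level. **Construction by blocks.** A finite poset can be built from a finite collection of disjoint finite posets, called blocks, together with a specification of which ordered pairs of blocks are connected. Connecting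 a block $B$ (starting block) to a block $B'$ (ending block) means adding a directed edge from every vertex on the last (top) level of $B$ to every vertex on the first (bottom) level of $B'$, so that each such vertex of $B$ is smaller than each such vertex of $B'$. The resulting partial order is the one generated (by reflexive and transitive closure) by the orders of the blocks and these added relations. **The space $X(G,S)$.** Let $S=\{g_1,\dots,g_n\}$ generate $G$. The colored directed Cayley graph of $(G,S)$ has vertex set $G$ and, for each $g\in G$ and each $1\le k\le n$, a directed edge $(g,g_kg)$ of color $k$. The finite space $X(G,S)$ is built by blocks, starting from the empty space, with two levels of blocks; connections always go from blocks in the first level of blocks (starting blocks) to blocks in the second level of blocks (ending blocks): 1. For every element $g\in G$, add a block that is a copy of $F_0$ on the first level of blocks (representing the vertex $g$). 2. For every $1\le k\le n$ and every edge $(g,g_kg)$ of color $k$ of the Cayley graph: (a) add a block that is a copy of $F_k$ on the first level of blocks, representing the edge $(g,g_kg)$; (b) add a block that is a copy of $F_{n+k}$ on the second level of blocks, representing the starting vertex of the edge, and connect to it the block of the edge $(g,g_kg)$ from (a) and the block of the vertex $g$ from step 1; (c) add a block that is a copy of $F_{2n+k}$ on the second level of blocks, representing the end point of the edge, and connect to it the block of the edge $(g,g_kg)$ from (a) and the block of the vertex $g_kg$ from step 1. *)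

theory Defs
  imports "HOL-Analysis.Analysis" "HOL-Algebra.Generated_Groups"
begin

section \<open>Finite posets and their topology\<close>

text \<open>A poset is a reflexive relation \<open>r\<close> with \<open>Partial_order r\<close>; its set of points is \<open>Field r\<close>,
  and \<open>(x, y) \<in> r\<close> means \<open>x \<le> y\<close>.\<close>

definition poset_topology :: "'a rel \<Rightarrow> 'a topology" where
  "poset_topology r =
     topology (\<lambda>U. U \<subseteq> Field r \<and> (\<forall>x\<in>U. \<forall>y. (y, x) \<in> r \<longrightarrow> y \<in> U))"

lemma openin_poset_topology:
  "openin (poset_topology r) U \<longleftrightarrow> U \<subseteq> Field r \<and> (\<forall>x\<in>U. \<forall>y. (y, x) \<in> r \<longrightarrow> y \<in> U)"
proof -
  have "istopology (\<lambda>U. U \<subseteq> Field r \<and> (\<forall>x\<in>U. \<forall>y. (y, x) \<in> r \<longrightarrow> y \<in> U))"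
    unfolding istopology_def by blast
  then show ?thesis
    by (simp add: poset_topology_def)
qed

lemma topspace_poset_topology [simp]: "topspace (poset_topology r) = Field r"
proof -
  have "openin (poset_topology r) (Field r)"
    by (auto simp: openin_poset_topology Field_def)
  then show ?thesis
    by (metis openin_poset_topology openin_subset openin_topspace subset_antisym)
qed

text \<open>\<open>min_open X x\<close> is \<open>U\<^sub>x\<close>; together with the lemma after it this recovers the order from the topology.\<close>

definition min_open :: "'a topology \<Rightarrow> 'a \<Rightarrow> 'a set" where
  "min_open X x = \<Inter> {U. openin X U \<and> x \<in> U}"

lemma poset_topology_le_iff:
  assumes "Partial_order r" "x \<in> Field r" "y \<in> Field r"
  shows "(x, y) \<in> r \<longleftrightarrow> min_open (poset_topology r) x \<subseteq> min_open (poset_topology r) y"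
proof -
  have *: "min_open (poset_topology r) z = {w. (w, z) \<in> r}" if "z \<in> Field r" for z
  proof -
    have "openin (poset_topology r) {w. (w, z) \<in> r}"
      using assms(1) by (auto simp: openin_poset_topology order_on_defs Field_def dest: transD)
    moreover have "z \<in> {w. (w, z) \<in> r}"
      using assms(1) that by (auto simp: order_on_defs refl_on_def)
    moreover have "{w. (w, z) \<in> r} \<subseteq> U" if "openin (poset_topology r) U" "z \<in> U" for U
      using that by (auto simp: openin_poset_topology)
    ultimately show ?thesis
      unfolding min_open_def by blast
  qed
  have "(x, x) \<in> r"
    using assms by (auto simp: order_on_defs refl_on_def)
  then show ?thesis
    using assms by (auto simp: * order_on_defs dest: transD)
qed

definition poset_level :: "'a rel \<Rightarrow> 'a \<Rightarrow> nat" where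
  "poset_level r x =
     Max {length xs | xs. xs \<noteq> [] \<and> set xs \<subseteq> Field r \<and> last xs = x \<and>
                          sorted_wrt (\<lambda>a b. (a, b) \<in> r \<and> a \<noteq> b) xs}"

definition level_set :: "'a rel \<Rightarrow> nat \<Rightarrow> 'a set" where
  "level_set r l = {x \<in> Field r. poset_level r x = l}"

definition top_level :: "'a rel \<Rightarrow> 'a set" where
  "top_level r = level_set r (Max (poset_level r ` Field r))"

definition bottom_level :: "'a rel \<Rightarrow> 'a set" where
  "bottom_level r = level_set r 1"

definition hasse_edges :: "'a rel \<Rightarrow> ('a \<times> 'a) set" where
  "hasse_edges r =
     {(x, y). (x, y) \<in> r \<and> x \<noteq> y \<and> \<not> (\<exists>z. (x, z) \<in> r \<and> (z, y) \<in> r \<and> z \<noteq> x \<and> z \<noteq> y)}"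

definition hasse_adj :: "'a rel \<Rightarrow> 'a \<Rightarrow> 'a \<Rightarrow> bool" where
  "hasse_adj r x y \<longleftrightarrow> (x, y) \<in> hasse_edges r \<or> (y, x) \<in> hasse_edges r"

definition hasse_degree :: "'a rel \<Rightarrow> 'a \<Rightarrow> nat" where
  "hasse_degree r x = card {y. hasse_adj r x y}"

section \<open>The posets \<open>F\<^sub>k\<close>\<close>

text \<open>The poset \<open>F\<^sub>k\<close> is only specified up to isomorphism, so it is described by a predicate. In the
  last two conditions \<open>3 - l\<close> is the level other than \<open>l \<in> {1, 2}\<close>, and \<open>a\<close>, \<open>b\<close> are the two vertices
  of degree \<open>2\<close> on level \<open>l\<close>; as both have degree \<open>2\<close>, the listed neighbours are all their
  neighbours.\<close>

definition is_F :: "nat \<Rightarrow> 'p rel \<Rightarrow> bool" where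
  "is_F k r \<longleftrightarrow>
     Partial_order r \<and> finite (Field r) \<and> card (Field r) = 2 * k + 8 \<and>
     Field r = level_set r 1 \<union> level_set r 2 \<and>
     (\<forall>(x, y) \<in> hasse_edges r. x \<in> level_set r 1 \<and> y \<in> level_set r 2) \<and>
     (\<forall>l\<in>{1, 2}.
        card (level_set r l) = k + 4 \<and>
        card {x \<in> level_set r l. hasse_degree r x = 2} = 2 \<and>
        (\<forall>i\<in>{3..k + 4}. card {x \<in> level_set r l. hasse_degree r x = i} = 1) \<and>
        (\<exists>a b. a \<noteq> b \<and> {x \<in> level_set r l. hasse_degree r x = 2} = {a, b} \<and>
           (\<exists>u\<in>level_set r (3 - l). hasse_degree r u = 2 \<and> hasse_adj r a u) \<and>
           (\<exists>u\<in>level_set r (3 - l). hasse_degree r u = k + 4 \<and> hasse_adj r a u) \<and>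
           (\<exists>u\<in>level_set r (3 - l). hasse_degree r u = k + 3 \<and> hasse_adj r b u) \<and>
           (\<exists>u\<in>level_set r (3 - l). hasse_degree r u = k + 4 \<and> hasse_adj r b u)))"

section \<open>Construction by blocks\<close>

text \<open>\<open>B i\<close> is the block with index \<open>i\<close>; pairing its points with \<open>i\<close> makes the blocks disjoint.
  The blocks are reflexive, so the transitive closure is already reflexive on the set of points.\<close>

definition block_poset :: "'i set \<Rightarrow> ('i \<Rightarrow> 'p rel) \<Rightarrow> ('i \<times> 'i) set \<Rightarrow> ('i \<times> 'p) rel" where
  "block_poset I B C =
     ({((i, x), (i, y)) | i x y. i \<in> I \<and> (x, y) \<in> B i} \<union>
      {((i, x), (j, y)) | i x j y. (i, j) \<in> C \<and> x \<in> top_level (B i) \<and> y \<in> bottom_level (B j)})\<^sup>+"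

section \<open>The space \<open>X(G, S)\<close>\<close>

text \<open>\<open>(k, g, h)\<close> is the edge from \<open>g\<close> to \<open>h\<close> of colour \<open>k\<close>. The generators are \<open>s 1, \<dots>, s n\<close>.\<close>

definition cayley_edges ::
    "('g, 'm) monoid_scheme \<Rightarrow> nat \<Rightarrow> (nat \<Rightarrow> 'g) \<Rightarrow> (nat \<times> 'g \<times> 'g) set" where
  "cayley_edges G n s = {(k, g, s k \<otimes>\<^bsub>G\<^esub> g) | k g. k \<in> {1..n} \<and> g \<in> carrier G}"

datatype 'g block =
    VertexBlock 'g
  | EdgeBlock "nat \<times> 'g \<times> 'g"
  | StartBlock "nat \<times> 'g \<times> 'g"
  | EndBlock "nat \<times> 'g \<times> 'g"

definition X_blocks :: "('g, 'm) monoid_scheme \<Rightarrow> nat \<Rightarrow> (nat \<Rightarrow> 'g) \<Rightarrow> 'g block set" where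
  "X_blocks G n s =
     VertexBlock ` carrier G \<union> EdgeBlock ` cayley_edges G n s \<union>
     StartBlock ` cayley_edges G n s \<union> EndBlock ` cayley_edges G n s"

fun block_index :: "nat \<Rightarrow> 'g block \<Rightarrow> nat" where
  "block_index n (VertexBlock g) = 0"
| "block_index n (EdgeBlock (k, g, h)) = k"
| "block_index n (StartBlock (k, g, h)) = n + k"
| "block_index n (EndBlock (k, g, h)) = 2 * n + k"

definition X_connections ::
    "('g, 'm) monoid_scheme \<Rightarrow> nat \<Rightarrow> (nat \<Rightarrow> 'g) \<Rightarrow> ('g block \<times> 'g block) set" where
  "X_connections G n s =
     (\<Union>(k, g, h) \<in> cayley_edges G n s.
        {(EdgeBlock (k, g, h), StartBlock (k, g, h)), (VertexBlock g, StartBlock (k, g, h)),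
         (EdgeBlock (k, g, h), EndBlock (k, g, h)), (VertexBlock h, EndBlock (k, g, h))})"

text \<open>\<open>F k\<close> is a chosen copy of \<open>F\<^sub>k\<close>.\<close>

definition X_poset ::
    "(nat \<Rightarrow> 'p rel) \<Rightarrow> ('g, 'm) monoid_scheme \<Rightarrow> nat \<Rightarrow> (nat \<Rightarrow> 'g) \<Rightarrow> ('g block \<times> 'p) rel" where
  "X_poset F G n s =
     block_poset (X_blocks G n s) (\<lambda>i. F (block_index n i)) (X_connections G n s)"

definition X_space ::
    "(nat \<Rightarrow> 'p rel) \<Rightarrow> ('g, 'm) monoid_scheme \<Rightarrow> nat \<Rightarrow> (nat \<Rightarrow> 'g) \<Rightarrow> ('g block \<times> 'p) topology" where
  "X_space F G n s = poset_topology (X_poset F G n s)"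

section \<open>Homotopy classes of self-homotopy equivalences\<close>

definition homotopy_equivalence_map :: "'a topology \<Rightarrow> 'b topology \<Rightarrow> ('a \<Rightarrow> 'b) \<Rightarrow> bool" where
  "homotopy_equivalence_map X Y f \<longleftrightarrow>
     continuous_map X Y f \<and>
     (\<exists>g. continuous_map Y X g \<and>
          homotopic_with (\<lambda>_. True) X X (g \<circ> f) id \<and> homotopic_with (\<lambda>_. True) Y Y (f \<circ> g) id)"

text \<open>Maps are total functions, but \<^const>\<open>homotopic_with\<close> disregards values outside the
  topspace, so maps agreeing on the topspace lie in the same class.\<close>

definition homotopy_rel :: "'a topology \<Rightarrow> ('a \<Rightarrow> 'a) rel" where
  "homotopy_rel X = {(f, g). homotopic_with (\<lambda>_. True) X X f g}"

definition self_equivalence_group :: "'a topology \<Rightarrow> ('a \<Rightarrow> 'a) set monoid" where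
  "self_equivalence_group X =
     \<lparr>carrier = {f. homotopy_equivalence_map X X f} // homotopy_rel X,
      mult = (\<lambda>A B. \<Union>f\<in>A. \<Union>g\<in>B. homotopy_rel X `` {f \<circ> g}),
      one = homotopy_rel X `` {id}\<rparr>"

section \<open>Consistency of the definitions\<close>

subsection \<open>The posets \<open>F\<^sub>k\<close> exist\<close>

definition F_model :: "nat \<Rightarrow> (bool \<times> nat) rel" where
  "F_model k =
     {(x, x) | x. x \<in> UNIV \<times> {1..k + 4}} \<union>
     {((False, i), (True, j)) | i j.
        i \<in> {1..k + 4} \<and> j \<in> {1..k + 4} \<and> (k + 5 \<le> i + j \<or> i = 1 \<and> j = 1)}"

lemma Field_F_model: "Field (F_model k) = UNIV \<times> {1..k + 4}"
  by (auto simp: F_model_def Field_def)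

lemma F_model_less:
  "(x, y) \<in> F_model k \<and> x \<noteq> y \<longleftrightarrow>
     (\<exists>i j. x = (False, i) \<and> y = (True, j) \<and> i \<in> {1..k + 4} \<and> j \<in> {1..k + 4} \<and>
            (k + 5 \<le> i + j \<or> i = 1 \<and> j = 1))"
  by (auto simp: F_model_def)

lemma Partial_order_F_model: "Partial_order (F_model k)"
  unfolding order_on_defs Field_F_model
  by (auto simp: F_model_def refl_on_def intro!: transI antisymI)

lemma poset_level_F_model:
  assumes "i \<in> {1..k + 4}"
  shows "poset_level (F_model k) (c, i) = (if c then 2 else 1)"
proof -
  let ?R = "\<lambda>a b. (a, b) \<in> F_model k \<and> a \<noteq> b"
  let ?L = "{length xs | xs. xs \<noteq> [] \<and> set xs \<subseteq> Field (F_model k) \<and> last xs = (c, i) \<and>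
               sorted_wrt ?R xs}"
  have short: "length xs \<le> (if c then 2 else 1)"
    if "xs \<noteq> []" "last xs = (c, i)" "sorted_wrt ?R xs" for xs
  proof (cases xs rule: rev_cases)
    case (snoc ys y)
    then have y: "y = (c, i)" and ys: "sorted_wrt ?R ys" "\<forall>x\<in>set ys. ?R x y"
      using that by (auto simp: sorted_wrt_append)
    show ?thesis
    proof (cases ys)
      case (Cons a zs)
      have "zs = []"
      proof (rule ccontr)
        assume "zs \<noteq> []"
        then obtain b ws where "zs = b # ws" by (cases zs) auto
        then have "?R a b" "?R b y" using ys Cons by auto
        then show False unfolding F_model_less by auto
      qed
      moreover have "?R a y" using ys Cons by auto
      ultimately show ?thesis
        using snoc Cons y unfolding F_model_less by auto
    qed (use snoc in auto)
  qed (use that in auto)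
  have one: "1 \<in> ?L"
    using assms by (auto simp: Field_F_model intro!: exI[of _ "[(c, i)]"])
  have two: "2 \<in> ?L" if c
  proof -
    have "((False, k + 4), (True, i)) \<in> F_model k"
      using assms by (auto simp: F_model_def)
    then show ?thesis
      using that assms by (auto simp: Field_F_model intro!: exI[of _ "[(False, k + 4), (c, i)]"])
  qed
  have "finite ?L"
    by (rule finite_subset[of _ "{..2}"]) (use short in \<open>fastforce split: if_splits\<close>)+
  then show ?thesis
    unfolding poset_level_def
    by (intro Max_eqI) (use one two short in \<open>auto split: if_splits\<close>)
qed

lemma level_set_F_model:
  "level_set (F_model k) l = (if l = 1 then {False} \<times> {1..k + 4}
     else if l = 2 then {True} \<times> {1..k + 4} else {})"
  by (auto simp: level_set_def Field_F_model poset_level_F_model split: if_splits)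

lemma hasse_edges_F_model:
  "hasse_edges (F_model k) =
     {((False, i), (True, j)) | i j.
        i \<in> {1..k + 4} \<and> j \<in> {1..k + 4} \<and> (k + 5 \<le> i + j \<or> i = 1 \<and> j = 1)}"
  by (auto simp: hasse_edges_def F_model_def)

lemma hasse_adj_F_model:
  "hasse_adj (F_model k) (c, i) (d, j) \<longleftrightarrow>
     c \<noteq> d \<and> i \<in> {1..k + 4} \<and> j \<in> {1..k + 4} \<and> (k + 5 \<le> i + j \<or> i = 1 \<and> j = 1)"
  by (cases c; cases d) (auto simp: hasse_adj_def hasse_edges_F_model)

lemma hasse_degree_F_model:
  assumes "i \<in> {1..k + 4}"
  shows "hasse_degree (F_model k) (c, i) = (if i = 1 then 2 else i)"
proof -
  have "{y. hasse_adj (F_model k) (c, i) y} =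
          {\<not> c} \<times> (if i = 1 then {1, k + 4} else {k + 5 - i..k + 4})"
    using assms by (auto simp: hasse_adj_F_model split: if_splits)
  then show ?thesis
    using assms by (auto simp: hasse_degree_def card_cartesian_product)
qed

lemma is_F_F_model: "is_F k (F_model k)"
proof -
  have lev: "level_set (F_model k) l = {l = 2} \<times> {1..k + 4}" if "l \<in> {1, 2}" for l
    using that by (auto simp: level_set_F_model)
  have deg: "{x \<in> level_set (F_model k) l. hasse_degree (F_model k) x = d} =
      (if d = 2 then {(l = 2, 1), (l = 2, 2)} else {(l = 2, d)})"
    if "l \<in> {1, 2}" "d \<in> {2..k + 4}" for l d
    using that by (auto simp: lev hasse_degree_F_model split: if_splits)
  have nb: "\<exists>u\<in>level_set (F_model k) (3 - l).
      hasse_degree (F_model k) u = d \<and> hasse_adj (F_model k) (l = 2, i) u"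
    if "l \<in> {1, 2}" "j \<in> {1..k + 4}" "i \<in> {1..k + 4}" "k + 5 \<le> i + j \<or> i = 1 \<and> j = 1"
       "d = (if j = 1 then 2 else j)" for l i j d
  proof -
    have "3 - l \<in> {1, 2}" using that by auto
    then have "(3 - l = 2, j) \<in> level_set (F_model k) (3 - l)"
      unfolding lev[OF \<open>3 - l \<in> {1, 2}\<close>] using that(2) by simp
    moreover have "hasse_degree (F_model k) (3 - l = 2, j) = d"
      unfolding hasse_degree_F_model[OF that(2)] that(5) ..
    moreover have "(l = 2) \<noteq> (3 - l = 2)"
      using that(1) by auto
    then have "hasse_adj (F_model k) (l = 2, i) (3 - l = 2, j)"
      unfolding hasse_adj_F_model using that(2-4) by blast
    ultimately show ?thesis by blast
  qed
  show ?thesis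
    unfolding is_F_def
  proof (intro conjI ballI)
    show "Partial_order (F_model k)" by (rule Partial_order_F_model)
    show "finite (Field (F_model k))" by (simp add: Field_F_model)
    show "card (Field (F_model k)) = 2 * k + 8"
      unfolding Field_F_model card_cartesian_product by simp
    show "Field (F_model k) = level_set (F_model k) 1 \<union> level_set (F_model k) 2"
      by (auto simp: Field_F_model level_set_F_model)
    show "case e of (x, y) \<Rightarrow> x \<in> level_set (F_model k) 1 \<and> y \<in> level_set (F_model k) 2"
      if "e \<in> hasse_edges (F_model k)" for e
      using that by (auto simp: hasse_edges_F_model level_set_F_model)
  next
    fix l :: nat assume l: "l \<in> {1, 2}"
    show "card (level_set (F_model k) l) = k + 4"
      unfolding lev[OF l] card_cartesian_product by simp
    show "card {x \<in> level_set (F_model k) l. hasse_degree (F_model k) x = 2} = 2"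
      using l by (subst deg) auto
    show "card {x \<in> level_set (F_model k) l. hasse_degree (F_model k) x = i} = 1"
      if "i \<in> {3..k + 4}" for i
      using l that by (subst deg) auto
    show "\<exists>a b. a \<noteq> b \<and>
      {x \<in> level_set (F_model k) l. hasse_degree (F_model k) x = 2} = {a, b} \<and>
      (\<exists>u\<in>level_set (F_model k) (3 - l). hasse_degree (F_model k) u = 2 \<and> hasse_adj (F_model k) a u) \<and>
      (\<exists>u\<in>level_set (F_model k) (3 - l). hasse_degree (F_model k) u = k + 4 \<and> hasse_adj (F_model k) a u) \<and>
      (\<exists>u\<in>level_set (F_model k) (3 - l). hasse_degree (F_model k) u = k + 3 \<and> hasse_adj (F_model k) b u) \<and>
      (\<exists>u\<in>level_set (F_model k) (3 - l). hasse_degree (F_model k) u = k + 4 \<and> hasse_adj (F_model k) b u)"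
    proof (rule exI[of _ "(l = 2, 1)"], rule exI[of _ "(l = 2, 2)"], intro conjI)
      show "(l = 2, 1::nat) \<noteq> (l = 2, 2)" by simp
      show "{x \<in> level_set (F_model k) l. hasse_degree (F_model k) x = 2} = {(l = 2, 1), (l = 2, 2)}"
        using deg[OF l, of 2] by simp
      let ?N = "\<lambda>d i. \<exists>u\<in>level_set (F_model k) (3 - l).
        hasse_degree (F_model k) u = d \<and> hasse_adj (F_model k) (l = 2, i) u"
      show "?N 2 1" by (rule nb[OF l, of 1]) simp_all
      show "?N (k + 4) 1" by (rule nb[OF l, of "k + 4"]) simp_all
      show "?N (k + 3) 2" by (rule nb[OF l, of "k + 3"]) simp_all
      show "?N (k + 4) 2" by (rule nb[OF l, of "k + 4"]) simp_all
    qed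
  qed
qed

subsection \<open>The block construction yields a partial order\<close>

lemma Partial_order_X_poset:
  fixes G :: "('g, 'm) monoid_scheme" and F :: "nat \<Rightarrow> 'p rel"
  assumes F: "\<And>k. is_F k (F k)" and G: "group G" and s: "s ` {1..n} \<subseteq> carrier G"
  shows "Partial_order (X_poset F G n s)"
    and "Field (X_poset F G n s) = (SIGMA i : X_blocks G n s. Field (F (block_index n i)))"
proof -
  interpret group G by (rule G)
  define I where "I = X_blocks G n s"
  define B where "B = (\<lambda>i :: 'g block. F (block_index n i))"
  define R where "R = {((i, x), (i, y)) | i x y. i \<in> I \<and> (x, y) \<in> B i} \<union>
      {((i, x), (j, y)) | i x j y. (i, j) \<in> X_connections G n s \<and>
         x \<in> top_level (B i) \<and> y \<in> bottom_level (B j)}"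
  have X: "X_poset F G n s = R\<^sup>+"
    by (simp add: X_poset_def block_poset_def R_def I_def B_def)
  have po: "Partial_order (B i)" for i
    using F[of "block_index n i"] unfolding B_def is_F_def by blast
  define lower where
    "lower i = (case i of VertexBlock _ \<Rightarrow> True | EdgeBlock _ \<Rightarrow> True | _ \<Rightarrow> False)" for i :: "'g block"
  have conn: "i \<in> I \<and> j \<in> I \<and> lower i \<and> \<not> lower j" if "(i, j) \<in> X_connections G n s" for i j
    using that s unfolding X_connections_def I_def X_blocks_def cayley_edges_def lower_def
    by fastforce
  have tb: "top_level (B i) \<subseteq> Field (B i)" "bottom_level (B i) \<subseteq> Field (B i)" for i
    by (auto simp: top_level_def bottom_level_def level_set_def)
  have R_Field: "Field R = (SIGMA i : I. Field (B i))"
  proof (intro subset_antisym subsetI)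
    fix p assume "p \<in> Field R"
    then obtain q where "(p, q) \<in> R \<or> (q, p) \<in> R"
      by (auto simp: Field_def)
    then show "p \<in> (SIGMA i : I. Field (B i))"
      unfolding R_def by (auto dest: conn subsetD[OF tb(1)] subsetD[OF tb(2)] intro: FieldI1 FieldI2)
  next
    fix p assume "p \<in> (SIGMA i : I. Field (B i))"
    then obtain i x where p: "p = (i, x)" "i \<in> I" "x \<in> Field (B i)"
      by auto
    then have "(x, x) \<in> B i"
      using po[of i] unfolding order_on_defs refl_on_def by blast
    then have "(p, p) \<in> R"
      using p unfolding R_def by auto
    then show "p \<in> Field R"
      by (rule FieldI1)
  qed
  have Fld: "Field (R\<^sup>+) = Field R"
    by (simp add: Field_def)
  have R_step: "fst p = fst q \<and> (snd p, snd q) \<in> B (fst p) \<or> lower (fst p) \<and> \<not> lower (fst q)"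
    if "(p, q) \<in> R" for p q
    using that unfolding R_def by (auto dest: conn)
  have key: "fst p = fst q \<and> (snd p, snd q) \<in> B (fst p) \<or> lower (fst p) \<and> \<not> lower (fst q)"
    if "(p, q) \<in> R\<^sup>+" for p q
    using that
  proof (induction rule: trancl_induct)
    case (step q r)
    have "trans (B (fst p))" using po by (auto simp: order_on_defs)
    then show ?case
      using step.IH R_step[OF step.hyps(2)] by (metis transD)
  qed (rule R_step)
  have "antisym (R\<^sup>+)"
  proof (rule antisymI)
    fix p q assume pq: "(p, q) \<in> R\<^sup>+" "(q, p) \<in> R\<^sup>+"
    have "antisym (B (fst p))" using po by (auto simp: order_on_defs)
    then show "p = q"
      using key[OF pq(1)] key[OF pq(2)] by (metis antisymD prod.expand)
  qed
  moreover have "refl_on (Field R) (R\<^sup>+)"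
  proof (rule refl_onI)
    fix p assume "p \<in> Field R"
    then have "fst p \<in> I" "snd p \<in> Field (B (fst p))"
      by (auto simp: R_Field)
    then have "(snd p, snd p) \<in> B (fst p)"
      using po[of "fst p"] by (auto simp: order_on_defs refl_on_def)
    then have "((fst p, snd p), (fst p, snd p)) \<in> R"
      using \<open>fst p \<in> I\<close> unfolding R_def by blast
    then show "(p, p) \<in> R\<^sup>+" by auto
  qed
  moreover have "R\<^sup>+ \<subseteq> Field R \<times> Field R"
  proof (rule subrelI)
    fix p q assume "(p, q) \<in> R\<^sup>+"
    then have "p \<in> Field (R\<^sup>+)" "q \<in> Field (R\<^sup>+)"
      by (rule FieldI1, rule FieldI2)
    then show "(p, q) \<in> Field R \<times> Field R"
      unfolding Fld by blast
  qed
  ultimately show "Partial_order (X_poset F G n s)"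
    unfolding X Fld order_on_defs by simp
  show "Field (X_poset F G n s) = (SIGMA i : X_blocks G n s. Field (F (block_index n i)))"
    unfolding X Fld R_Field by (simp add: I_def B_def)
qed

subsection \<open>Self-homotopy equivalences up to homotopy form a group\<close>

lemma equiv_homotopy_rel: "equiv {f. continuous_map X X f} (homotopy_rel X)"
  by (auto simp: equiv_def refl_on_def homotopy_rel_def homotopic_with_imp_continuous_maps
      intro!: symI transI dest: homotopic_with_symD homotopic_with_trans homotopic_with_imp_continuous_maps)

lemma homotopic_with_comp:
  assumes "homotopic_with (\<lambda>_. True) X X f f'" "homotopic_with (\<lambda>_. True) X X g g'"
  shows "homotopic_with (\<lambda>_. True) X X (f \<circ> g) (f' \<circ> g')"
  by (rule homotopic_compose[OF assms(2) assms(1)])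

lemma homotopy_equivalence_map_homotopic:
  assumes "homotopy_equivalence_map X X f" "homotopic_with (\<lambda>_. True) X X f f'"
  shows "homotopy_equivalence_map X X f'"
proof -
  obtain g where g: "continuous_map X X g" "homotopic_with (\<lambda>_. True) X X (g \<circ> f) id"
      "homotopic_with (\<lambda>_. True) X X (f \<circ> g) id"
    using assms(1) by (auto simp: homotopy_equivalence_map_def)
  have f': "homotopic_with (\<lambda>_. True) X X f' f" and gg: "homotopic_with (\<lambda>_. True) X X g g"
    using assms(2) g(1) by (auto intro: homotopic_with_symD)
  have "homotopic_with (\<lambda>_. True) X X (g \<circ> f') id"
    using homotopic_with_trans[OF homotopic_with_comp[OF gg f'] g(2)] .
  moreover have "homotopic_with (\<lambda>_. True) X X (f' \<circ> g) id"
    using homotopic_with_trans[OF homotopic_with_comp[OF f' gg] g(3)] .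
  ultimately show ?thesis
    unfolding homotopy_equivalence_map_def
    using g(1) homotopic_with_imp_continuous_maps[OF f'] by blast
qed

lemma homotopy_equivalence_map_comp:
  assumes "homotopy_equivalence_map X X f" "homotopy_equivalence_map X X g"
  shows "homotopy_equivalence_map X X (f \<circ> g)"
proof -
  obtain f' where f': "continuous_map X X f'" "homotopic_with (\<lambda>_. True) X X (f' \<circ> f) id"
      "homotopic_with (\<lambda>_. True) X X (f \<circ> f') id"
    using assms(1) by (auto simp: homotopy_equivalence_map_def)
  obtain g' where g': "continuous_map X X g'" "homotopic_with (\<lambda>_. True) X X (g' \<circ> g) id"
      "homotopic_with (\<lambda>_. True) X X (g \<circ> g') id"
    using assms(2) by (auto simp: homotopy_equivalence_map_def)
  have c: "continuous_map X X f" "continuous_map X X g"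
    using assms by (auto simp: homotopy_equivalence_map_def)
  have r: "homotopic_with (\<lambda>_. True) X X h h" if "continuous_map X X h" for h
    using that by simp
  have "homotopic_with (\<lambda>_. True) X X (g' \<circ> ((f' \<circ> f) \<circ> g)) (g' \<circ> (id \<circ> g))"
    by (intro homotopic_with_comp r c g' f')
  then have "homotopic_with (\<lambda>_. True) X X ((g' \<circ> f') \<circ> (f \<circ> g)) id"
    using homotopic_with_trans[OF _ g'(2)] by (simp add: comp_assoc)
  moreover have "homotopic_with (\<lambda>_. True) X X (f \<circ> ((g \<circ> g') \<circ> f')) (f \<circ> (id \<circ> f'))"
    by (intro homotopic_with_comp r c g' f')
  then have "homotopic_with (\<lambda>_. True) X X ((f \<circ> g) \<circ> (g' \<circ> f')) id"
    using homotopic_with_trans[OF _ f'(3)] by (simp add: comp_assoc)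
  ultimately show ?thesis
    unfolding homotopy_equivalence_map_def
    using c f'(1) g'(1) by (blast intro: continuous_map_compose)
qed

lemma mult_self_equivalence_group:
  assumes "continuous_map X X f" "continuous_map X X g"
  shows "homotopy_rel X `` {f} \<otimes>\<^bsub>self_equivalence_group X\<^esub> homotopy_rel X `` {g} =
         homotopy_rel X `` {f \<circ> g}"
proof -
  have "homotopy_rel X `` {f' \<circ> g'} = homotopy_rel X `` {f \<circ> g}"
    if "f' \<in> homotopy_rel X `` {f}" "g' \<in> homotopy_rel X `` {g}" for f' g'
  proof -
    have "(f \<circ> g, f' \<circ> g') \<in> homotopy_rel X"
      using that homotopic_with_comp[of X f f' g g'] by (simp add: homotopy_rel_def)
    then show ?thesis
      using equiv_class_eq[OF equiv_homotopy_rel] by metis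
  qed
  then have "(\<Union>f'\<in>homotopy_rel X `` {f}. \<Union>g'\<in>homotopy_rel X `` {g}. homotopy_rel X `` {f' \<circ> g'}) =
      (\<Union>f'\<in>homotopy_rel X `` {f}. \<Union>g'\<in>homotopy_rel X `` {g}. homotopy_rel X `` {f \<circ> g})"
    by (intro SUP_cong refl)
  moreover have "f \<in> homotopy_rel X `` {f}" "g \<in> homotopy_rel X `` {g}"
    using assms by (simp_all add: homotopy_rel_def)
  then have "homotopy_rel X `` {f} \<noteq> {}" "homotopy_rel X `` {g} \<noteq> {}"
    by blast+
  ultimately show ?thesis
    by (simp add: self_equivalence_group_def)
qed

lemma group_self_equivalence_group: "group (self_equivalence_group X)"
proof -
  define E where "E = self_equivalence_group X"
  define c where "c f = homotopy_rel X `` {f}" for f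
  have carrier: "carrier E = c ` {f. homotopy_equivalence_map X X f}"
    by (auto simp: E_def self_equivalence_group_def quotient_def c_def)
  have one: "\<one>\<^bsub>E\<^esub> = c id"
    by (simp add: E_def self_equivalence_group_def c_def)
  have cont: "continuous_map X X f" if "homotopy_equivalence_map X X f" for f
    using that by (simp add: homotopy_equivalence_map_def)
  have mult: "c f \<otimes>\<^bsub>E\<^esub> c g = c (f \<circ> g)"
    if "homotopy_equivalence_map X X f" "homotopy_equivalence_map X X g" for f g
    unfolding E_def c_def using that by (intro mult_self_equivalence_group cont)
  have id: "homotopy_equivalence_map X X id"
    unfolding homotopy_equivalence_map_def by (auto intro!: exI[of _ id])
  have inv: "\<exists>g. homotopy_equivalence_map X X g \<and> c (g \<circ> f) = c id"
    if f: "homotopy_equivalence_map X X f" for f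
  proof -
    obtain g where g: "continuous_map X X g" "homotopic_with (\<lambda>_. True) X X (g \<circ> f) id"
        "homotopic_with (\<lambda>_. True) X X (f \<circ> g) id"
      using f by (auto simp: homotopy_equivalence_map_def)
    then have "homotopy_equivalence_map X X g"
      using cont[OF f] by (auto simp: homotopy_equivalence_map_def)
    moreover have "c (g \<circ> f) = c id"
      using g(2) equiv_class_eq[OF equiv_homotopy_rel] unfolding c_def homotopy_rel_def by blast
    ultimately show ?thesis by blast
  qed
  have "group E"
  proof (rule groupI)
    fix x y z assume "x \<in> carrier E" "y \<in> carrier E" "z \<in> carrier E"
    then show "x \<otimes>\<^bsub>E\<^esub> y \<otimes>\<^bsub>E\<^esub> z = x \<otimes>\<^bsub>E\<^esub> (y \<otimes>\<^bsub>E\<^esub> z)"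
      by (auto simp: carrier mult homotopy_equivalence_map_comp comp_assoc)
  next
    fix x assume "x \<in> carrier E"
    then obtain f where f: "x = c f" "homotopy_equivalence_map X X f"
      by (auto simp: carrier)
    obtain g where g: "homotopy_equivalence_map X X g" "c (g \<circ> f) = c id"
      using inv[OF f(2)] by blast
    have "c g \<otimes>\<^bsub>E\<^esub> x = \<one>\<^bsub>E\<^esub>"
      using f g by (simp add: mult one)
    then show "\<exists>y\<in>carrier E. y \<otimes>\<^bsub>E\<^esub> x = \<one>\<^bsub>E\<^esub>"
      using g(1) by (auto simp: carrier)
  qed (auto simp: carrier mult one id homotopy_equivalence_map_comp)
  then show ?thesis by (simp add: E_def)
qed

end

theory Submission
  imports Defs
begin

text \<open>The space \<open>X(G, S)\<close> has no beat points, so self-maps homotopic to the identity are equal to the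
  identity and the group in question is the automorphism group of the poset. An automorphism permutes
  the blocks: blocks receiving connections are recognised by chains, and each block is connected. It
  preserves the size of a block, hence its index, and is the identity inside blocks because \<open>F\<^sub>k\<close> is
  rigid. What remains is an automorphism of the coloured Cayley graph, that is, a permutation of \<open>G\<close>
  commuting with all left multiplications by generators; these are the right translations.\<close>

section \<open>Finite spaces without beat points\<close>

text \<open>The obstacle is that an automorphism of the poset has no a priori reason to respect the
  blocks: a connection puts every point of one block below every point of the other, so mere
  comparability does not show where a block ends. What helps is that connections never compose, so a
  block that receives one never starts one.

  The indices \<open>0\<close>, \<open>k\<close>, \<open>n + k\<close>, \<open>2 * n + k\<close>
  with \<open>k\<close> in \<open>{1..n}\<close> fill disjoint ranges, so the number
  \<open>2 * m + 8\<close> of points of \<open>F m\<close> reveals both the role of a block and its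
  colour. Each edge gets separate start and end blocks because its two vertices both lie below the
  blocks that join them to the edge; the order alone would not remember the orientation.

  Right translations compose in reverse order, so the isomorphism sends \<open>g\<close> to
  translation by the inverse of \<open>g\<close>.\<close>

definition order_automorphism :: "'a rel \<Rightarrow> ('a \<Rightarrow> 'a) \<Rightarrow> bool" where
  "order_automorphism r f \<longleftrightarrow> bij_betw f (Field r) (Field r) \<and>
     (\<forall>x\<in>Field r. \<forall>y\<in>Field r. (f x, f y) \<in> r \<longleftrightarrow> (x, y) \<in> r)"

lemma order_automorphismI:
  assumes "Partial_order r"
    and "\<And>p q. (p, q) \<in> r \<Longrightarrow> (f p, f q) \<in> r" "\<And>p q. (p, q) \<in> r \<Longrightarrow> (g p, g q) \<in> r"
    and "\<And>p. p \<in> Field r \<Longrightarrow> g (f p) = p" "\<And>p. p \<in> Field r \<Longrightarrow> f (g p) = p"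
  shows "order_automorphism r f"
proof -
  have "f p \<in> Field r" "g p \<in> Field r" if "p \<in> Field r" for p
  proof -
    have "(p, p) \<in> r"
      using assms(1) that by (auto simp: order_on_defs refl_on_def)
    then show "f p \<in> Field r" "g p \<in> Field r"
      using FieldI1[OF assms(2)] FieldI1[OF assms(3)] by blast+
  qed
  then have "bij_betw f (Field r) (Field r)"
    using assms(4,5) by (intro bij_betw_byWitness[of _ g]) auto
  moreover have "(f p, f q) \<in> r \<longleftrightarrow> (p, q) \<in> r" if "p \<in> Field r" "q \<in> Field r" for p q
    using assms(2)[of p q] assms(3)[of "f p" "f q"] assms(4) that by auto
  ultimately show ?thesis
    by (simp add: order_automorphism_def)
qed

lemma order_automorphism_inv_into:
  assumes "order_automorphism r f"
  shows "order_automorphism r (inv_into (Field r) f)"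
proof -
  let ?g = "inv_into (Field r) f"
  have b: "bij_betw f (Field r) (Field r)" "bij_betw ?g (Field r) (Field r)"
    using assms by (auto simp: order_automorphism_def bij_betw_inv_into)
  have "(?g x, ?g y) \<in> r \<longleftrightarrow> (x, y) \<in> r" if "x \<in> Field r" "y \<in> Field r" for x y
  proof -
    have "(f (?g x), f (?g y)) \<in> r \<longleftrightarrow> (?g x, ?g y) \<in> r"
      using assms that b(2) by (auto simp: order_automorphism_def bij_betw_apply)
    then show ?thesis
      using that b(1) by (simp add: bij_betw_inv_into_right)
  qed
  then show ?thesis
    using b(2) by (simp add: order_automorphism_def)
qed

text \<open>Up beat points of \<open>r\<close> are down beat points of the converse of \<open>r\<close>.\<close>

definition no_down_beat_point :: "'a rel \<Rightarrow> bool" where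
  "no_down_beat_point r \<longleftrightarrow>
     \<not> (\<exists>x m. (m, x) \<in> r \<and> m \<noteq> x \<and> (\<forall>y. (y, x) \<in> r \<and> y \<noteq> x \<longrightarrow> (y, m) \<in> r))"

text \<open>Principal down-sets are open. The preimage of the one below \<open>f y\<close> is
  therefore a down-set; it contains \<open>y\<close>, hence everything below
  \<open>y\<close>.\<close>

lemma continuous_map_poset_topology:
  assumes "Partial_order r" "Partial_order q"
  shows "continuous_map (poset_topology r) (poset_topology q) f \<longleftrightarrow>
    f ` Field r \<subseteq> Field q \<and> (\<forall>x y. (x, y) \<in> r \<longrightarrow> (f x, f y) \<in> q)"
    (is "?L \<longleftrightarrow> ?R")
proof
  assume L: ?L
  then have im: "f ` Field r \<subseteq> Field q"
    by (metis continuous_map_image_subset_topspace topspace_poset_topology)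
  have "(f x, f y) \<in> q" if "(x, y) \<in> r" for x y
  proof -
    have y: "y \<in> Field r" "f y \<in> Field q"
      using im FieldI2[OF that] by auto
    have "openin (poset_topology q) {w. (w, f y) \<in> q}"
      using assms(2) by (auto simp: openin_poset_topology order_on_defs Field_def dest: transD)
    then have "openin (poset_topology r) {z \<in> Field r. (f z, f y) \<in> q}"
      using openin_continuous_map_preimage[OF L] by fastforce
    moreover have "(f y, f y) \<in> q"
      using y assms(2) by (auto simp: order_on_defs refl_on_def)
    ultimately show ?thesis
      using that y(1) unfolding openin_poset_topology by blast
  qed
  with im show ?R by blast
next
  assume R: ?R
  have "openin (poset_topology r) {x \<in> Field r. f x \<in> V}" if "openin (poset_topology q) V" for V
    using that R by (auto simp: openin_poset_topology FieldI1)
  then show ?L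
    using R by (auto simp: continuous_map_def)
qed

text \<open>If \<open>f\<close> fixes everything strictly below \<open>x\<close>, monotonicity puts
  all of it below \<open>f x\<close>. Were \<open>f x\<close> strictly below \<open>x\<close>, it
  would be the largest point there, making \<open>x\<close> a down beat point. Finiteness supplies
  the well-founded induction.\<close>

lemma decreasing_map_eq_id:
  assumes "Partial_order r" "finite (Field r)" "no_down_beat_point r"
    and mono: "\<And>x y. (x, y) \<in> r \<Longrightarrow> (f x, f y) \<in> r"
    and dec: "\<And>x. x \<in> Field r \<Longrightarrow> (f x, x) \<in> r"
    and "x \<in> Field r"
  shows "f x = x"
proof -
  have tr: "trans r" and an: "antisym r"
    using assms(1) by (auto simp: order_on_defs)
  have "finite r"
    by (rule finite_subset[of _ "Field r \<times> Field r"]) (use assms(2) in \<open>auto intro: FieldI1 FieldI2\<close>)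
  then have "finite (r - Id)"
    by blast
  moreover have "acyclic (r - Id)"
  proof -
    have "(r - Id)\<^sup>+ \<subseteq> r - Id"
      using trancl_id[OF trans_diff_Id[OF tr an]] by simp
    then show ?thesis by (auto simp: acyclic_def)
  qed
  ultimately have "wf (r - Id)"
    by (rule finite_acyclic_wf)
  then show ?thesis
    using assms(6)
  proof (induction x rule: wf_induct_rule)
    case (less x)
    show ?case
    proof (rule ccontr)
      assume "f x \<noteq> x"
      moreover have "(y, f x) \<in> r" if "(y, x) \<in> r" "y \<noteq> x" for y
        using less.IH[of y] mono[OF that(1)] that FieldI1[OF that(1)] by auto
      ultimately show False
        using dec[OF less.prems] assms(3) unfolding no_down_beat_point_def by blast
    qed
  qed
qed

text \<open>By finiteness every \<open>t\<^sub>0\<close> has a neighbourhood on which \<open>H\<^sub>t \<le> H\<^bsub>t\<^sub>0\<^esub>\<close> pointwise. Without beat points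
  a map comparable to the identity is the identity, so \<open>H\<^sub>t = id\<close> is locally constant in \<open>t\<close>.\<close>

lemma homotopic_id_eq_id:
  assumes po: "Partial_order r" and fin: "finite (Field r)"
    and beat: "no_down_beat_point r" "no_down_beat_point (r\<inverse>)"
    and hom: "homotopic_with (\<lambda>_. True) (poset_topology r) (poset_topology r) f id"
    and x: "x \<in> Field r"
  shows "f x = x"
proof -
  let ?X = "poset_topology r" and ?I = "{0..1::real}"
  obtain h where h: "continuous_map (prod_topology (top_of_set ?I) ?X) ?X h"
    and h01: "\<And>x. h (0, x) = f x" "\<And>x. h (1, x) = x"
    using hom by (auto simp: homotopic_with_def)
  define fixed where "fixed t \<longleftrightarrow> (\<forall>x\<in>Field r. h (t, x) = x)" for t
  have slice: "continuous_map ?X ?X (\<lambda>x. h (t, x))" if "t \<in> ?I" for t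
  proof -
    have "continuous_map ?X (prod_topology (top_of_set ?I) ?X) (\<lambda>x. (t, x))"
      using that by (intro continuous_map_pairedI) auto
    from continuous_map_compose[OF this h] show ?thesis
      by (simp add: o_def)
  qed
  have mono: "(h (t, x), h (t, y)) \<in> r" if "t \<in> ?I" "(x, y) \<in> r" for t x y
    using slice[OF that(1)] that(2) by (auto simp: continuous_map_poset_topology[OF po po])
  have mapsto: "h (t, x) \<in> Field r" if "t \<in> ?I" "x \<in> Field r" for t x
    using slice[OF that(1)] that(2) by (auto simp: continuous_map_poset_topology[OF po po])
  have po': "Partial_order (r\<inverse>)"
    using po by simp
  have "fixed 0 \<longleftrightarrow> fixed 1"
  proof (rule connected_equivalence_relation[of ?I 0 1 "\<lambda>s t. fixed s \<longleftrightarrow> fixed t"])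
    fix a assume a: "a \<in> ?I"
    define N where "N = {t \<in> ?I. \<forall>x\<in>Field r. (h (t, x), h (a, x)) \<in> r}"
    have op: "openin (top_of_set ?I) {t \<in> ?I. (h (t, x), h (a, x)) \<in> r}" if "x \<in> Field r" for x
    proof -
      have "continuous_map (top_of_set ?I) (prod_topology (top_of_set ?I) ?X) (\<lambda>t. (t, x))"
        using that by (intro continuous_map_pairedI) auto
      then have "continuous_map (top_of_set ?I) ?X (h \<circ> (\<lambda>t. (t, x)))"
        using h by (rule continuous_map_compose)
      moreover have "openin ?X {w. (w, h (a, x)) \<in> r}"
        using po by (auto simp: openin_poset_topology order_on_defs Field_def dest: transD)
      ultimately show ?thesis
        using openin_continuous_map_preimage by fastforce
    qed
    have "openin (top_of_set ?I) N"
    \<comment> \<open>An intersection over an empty index set would be the whole type instead of the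
      interval.\<close>
    proof (cases "Field r = {}")
      case False
      have "N = (\<Inter>x\<in>Field r. {t \<in> ?I. (h (t, x), h (a, x)) \<in> r})"
        using False by (auto simp: N_def)
      then show ?thesis
        using op fin False by (simp only:) (intro openin_Inter, auto)
    next
      case True
      then have "N = ?I"
        by (auto simp: N_def)
      then show ?thesis
        by (simp only: openin_subtopology_self)
    qed
    moreover have "a \<in> N"
      using a mapsto po by (auto simp: N_def order_on_defs refl_on_def)
    moreover have "fixed a \<longleftrightarrow> fixed t" if "t \<in> N" for t
    proof
      have t: "t \<in> ?I" and le: "\<And>x. x \<in> Field r \<Longrightarrow> (h (t, x), h (a, x)) \<in> r"
        using that by (auto simp: N_def)
      show "fixed t" if "fixed a"
        using decreasing_map_eq_id[OF po fin beat(1), of "\<lambda>x. h (t, x)"] mono[OF t] le that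
        by (simp add: fixed_def)
      \<comment> \<open>Here the identity lies below \<open>h (a, _)\<close>, so this map is
        decreasing for the converse order; this is where up beat points are excluded.\<close>
      show "fixed a" if "fixed t"
        using decreasing_map_eq_id[OF po' _ beat(2), of "\<lambda>x. h (a, x)"] fin mono[OF a] le that
        by (simp add: fixed_def)
    qed
    ultimately show "\<exists>T. openin (top_of_set ?I) T \<and> a \<in> T \<and> (\<forall>x\<in>T. fixed a \<longleftrightarrow> fixed x)"
      by blast
  qed auto
  then show ?thesis
    using x by (simp add: fixed_def h01)
qed

text \<open>Both composites with a homotopy inverse are homotopic to the identity, hence equal to it
  on the points, so a homotopy inverse is a strict inverse.\<close>

lemma homotopy_equivalence_map_beat_free:
  assumes po: "Partial_order r" and fin: "finite (Field r)"
    and beat: "no_down_beat_point r" "no_down_beat_point (r\<inverse>)"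
  shows "homotopy_equivalence_map (poset_topology r) (poset_topology r) f \<longleftrightarrow> order_automorphism r f"
    (is "?L \<longleftrightarrow> ?R")
proof
  assume ?L
  then obtain g where g: "continuous_map (poset_topology r) (poset_topology r) g"
      "homotopic_with (\<lambda>_. True) (poset_topology r) (poset_topology r) (g \<circ> f) id"
      "homotopic_with (\<lambda>_. True) (poset_topology r) (poset_topology r) (f \<circ> g) id"
    and f: "continuous_map (poset_topology r) (poset_topology r) f"
    by (auto simp: homotopy_equivalence_map_def)
  have inv: "g (f x) = x" "f (g x) = x" if "x \<in> Field r" for x
    using homotopic_id_eq_id[OF assms g(2) that] homotopic_id_eq_id[OF assms g(3) that] by auto
  have "bij_betw f (Field r) (Field r)"
    using f g(1) by (intro bij_betw_byWitness[of _ g])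
      (auto simp: inv continuous_map_poset_topology[OF po po])
  moreover have "(f x, f y) \<in> r \<longleftrightarrow> (x, y) \<in> r" if "x \<in> Field r" "y \<in> Field r" for x y
    using f g(1) inv that unfolding continuous_map_poset_topology[OF po po] by metis
  ultimately show ?R
    by (simp add: order_automorphism_def)
next
  assume R: ?R
  define g where "g = inv_into (Field r) f"
  have b: "bij_betw f (Field r) (Field r)"
    and m: "\<And>x y. x \<in> Field r \<Longrightarrow> y \<in> Field r \<Longrightarrow> (f x, f y) \<in> r \<longleftrightarrow> (x, y) \<in> r"
    using R by (auto simp: order_automorphism_def)
  have inv: "g (f x) = x" "f (g x) = x" "g x \<in> Field r" "f x \<in> Field r" if "x \<in> Field r" for x
    using b that by (auto simp: g_def bij_betw_inv_into_left bij_betw_inv_into_right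
        bij_betw_apply bij_betw_apply[OF bij_betw_inv_into])
  have f: "continuous_map (poset_topology r) (poset_topology r) f"
    using inv m by (auto simp: continuous_map_poset_topology[OF po po] FieldI1 FieldI2)
  have "(g x, g y) \<in> r" if "(x, y) \<in> r" for x y
    using m[of "g x" "g y"] inv that FieldI1[OF that] FieldI2[OF that] by simp
  then have g: "continuous_map (poset_topology r) (poset_topology r) g"
    using inv by (auto simp: continuous_map_poset_topology[OF po po])
  show ?L
    unfolding homotopy_equivalence_map_def using f g inv
    by (intro conjI exI[of _ g] homotopic_with_equal) (auto intro: continuous_map_compose)
qed

text \<open>Composing with a homotopy inverse of \<open>g\<close> reduces this to maps homotopic to
  the identity.\<close>

lemma homotopic_automorphism_iff:
  assumes po: "Partial_order r" and fin: "finite (Field r)"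
    and beat: "no_down_beat_point r" "no_down_beat_point (r\<inverse>)"
    and f: "order_automorphism r f" and g: "order_automorphism r g"
  shows "homotopic_with (\<lambda>_. True) (poset_topology r) (poset_topology r) f g \<longleftrightarrow>
         (\<forall>x\<in>Field r. f x = g x)"
    (is "?L \<longleftrightarrow> ?R")
proof
  let ?X = "poset_topology r"
  have "homotopy_equivalence_map ?X ?X g"
    using g homotopy_equivalence_map_beat_free[OF assms(1-4)] by simp
  then obtain g' where g': "continuous_map ?X ?X g'"
      "homotopic_with (\<lambda>_. True) ?X ?X (g' \<circ> g) id" "homotopic_with (\<lambda>_. True) ?X ?X (g \<circ> g') id"
    by (auto simp: homotopy_equivalence_map_def)
  assume ?L
  show ?R
  proof
    fix x assume x: "x \<in> Field r"
    have "homotopic_with (\<lambda>_. True) ?X ?X g' g'"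
      using g'(1) by simp
    then have "homotopic_with (\<lambda>_. True) ?X ?X (g' \<circ> f) id"
      using homotopic_with_trans[OF homotopic_with_comp g'(2)] \<open>?L\<close> by blast
    then have "g' (f x) = x"
      using homotopic_id_eq_id[OF assms(1-4)] x by fastforce
    moreover have "g (g' (f x)) = f x"
      using homotopic_id_eq_id[OF assms(1-4) g'(3), of "f x"] f x
      by (auto simp: order_automorphism_def bij_betw_def)
    ultimately show "f x = g x"
      by simp
  qed
next
  let ?X = "poset_topology r"
  assume ?R
  moreover have "continuous_map ?X ?X f" "continuous_map ?X ?X g"
    using f g homotopy_equivalence_map_beat_free[OF assms(1-4)]
    by (auto simp: homotopy_equivalence_map_def)
  ultimately show ?L
    by (intro homotopic_with_equal) auto
qed

section \<open>Sums of two-level posets\<close>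

text \<open>What the block arguments need from \<open>F k\<close>. \<open>two_above\<close> and
  \<open>two_below\<close> exclude beat points inside a block, and the two hubs make a block
  connected. The list is self-dual, so results about lower points transfer to upper ones.\<close>

locale two_level_poset =
  fixes r :: "'p rel" and L U :: "'p set"
  assumes partial_order: "Partial_order r"
    and Field_eq: "Field r = L \<union> U"
    and disjoint: "L \<inter> U = {}"
    and strict: "(x, y) \<in> r \<Longrightarrow> x \<noteq> y \<Longrightarrow> x \<in> L \<and> y \<in> U"
    and two_above: "x \<in> L \<Longrightarrow> \<exists>y\<in>U. \<exists>z\<in>U. y \<noteq> z \<and> (x, y) \<in> r \<and> (x, z) \<in> r"
    and two_below: "x \<in> U \<Longrightarrow> \<exists>y\<in>L. \<exists>z\<in>L. y \<noteq> z \<and> (y, x) \<in> r \<and> (z, x) \<in> r"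
    and lower_hub: "\<exists>u\<in>L. \<forall>y\<in>U. (u, y) \<in> r"
    and upper_hub: "\<exists>v\<in>U. \<forall>x\<in>L. (x, v) \<in> r"
begin

lemma refl: "x \<in> Field r \<Longrightarrow> (x, x) \<in> r"
  using partial_order by (auto simp: order_on_defs refl_on_def)

lemma dual: "two_level_poset (r\<inverse>) U L"
proof
  show "Partial_order (r\<inverse>)" using partial_order by simp
  show "x \<in> U \<and> y \<in> L" if "(x, y) \<in> r\<inverse>" "x \<noteq> y" for x y
    using strict[of y x] that by auto
qed (use Field_eq disjoint two_above two_below lower_hub upper_hub in auto)

text \<open>Needed for a point above a whole block: no member of that block can dominate the rest. A
  maximum would lie above two distinct upper points, but each of these has nothing strictly above
  it.\<close>

lemma no_max: "\<exists>x\<in>Field r. (x, m) \<notin> r"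
proof (rule ccontr)
  assume *: "\<not> ?thesis"
  obtain u where "u \<in> L"
    using lower_hub by blast
  then obtain y z where yz: "y \<in> U" "z \<in> U" "y \<noteq> z"
    using two_above by blast
  then have "(y, m) \<in> r" "(z, m) \<in> r"
    using * Field_eq by auto
  then have "y = m" "z = m"
    using strict disjoint yz by blast+
  with yz show False by simp
qed

end

text \<open>When every point of a block lies below a top point and above a bottom point, and no two
  connections compose, the transitive closure in \<^const>\<open>block_poset\<close> collapses to this relation.\<close>

definition block_sum :: "'i set \<Rightarrow> ('i \<Rightarrow> 'p rel) \<Rightarrow> ('i \<times> 'i) set \<Rightarrow> ('i \<times> 'p) rel" where
  "block_sum I B C =
     {((i, x), (i, y)) | i x y. i \<in> I \<and> (x, y) \<in> B i} \<union>
     {((i, x), (j, y)) | i x j y. (i, j) \<in> C \<and> x \<in> Field (B i) \<and> y \<in> Field (B j)}"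

lemma block_sum_iff:
  "((i, x), (j, y)) \<in> block_sum I B C \<longleftrightarrow>
     i = j \<and> i \<in> I \<and> (x, y) \<in> B i \<or> (i, j) \<in> C \<and> x \<in> Field (B i) \<and> y \<in> Field (B j)"
  by (auto simp: block_sum_def)

lemma converse_block_sum: "(block_sum I B C)\<inverse> = block_sum I (\<lambda>i. (B i)\<inverse>) (C\<inverse>)"
  by (auto simp: block_sum_def)

text \<open>\<open>C_comp\<close> makes \<open>C\<close> bipartite in effect: besides paths of
  length two it excludes loops (\<open>i = j = k\<close>) and two-cycles
  (\<open>k = i\<close>).\<close>

locale block_system =
  fixes I :: "'i set" and B :: "'i \<Rightarrow> 'p rel" and L U :: "'i \<Rightarrow> 'p set" and C :: "('i \<times> 'i) set"
  assumes block: "i \<in> I \<Longrightarrow> two_level_poset (B i) (L i) (U i)"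
    and C_subset: "C \<subseteq> I \<times> I"
    and C_comp: "(i, j) \<in> C \<Longrightarrow> (j, k) \<notin> C"
begin

abbreviation "S \<equiv> block_sum I B C"

lemma dual: "block_system I (\<lambda>i. (B i)\<inverse>) U L (C\<inverse>)"
proof (rule block_system.intro)
  show "two_level_poset ((B i)\<inverse>) (U i) (L i)" if "i \<in> I" for i
    using block[OF that] by (rule two_level_poset.dual)
qed (use C_subset C_comp in auto)

lemma Field_S: "Field S = (SIGMA i : I. Field (B i))"
proof -
  have "((i, x), (i, x)) \<in> S" if "i \<in> I" "x \<in> Field (B i)" for i x
    using that two_level_poset.refl[OF block] by (simp add: block_sum_iff)
  then have "(SIGMA i : I. Field (B i)) \<subseteq> Field S"
    by (force intro: FieldI1)
  moreover have "p \<in> (SIGMA i : I. Field (B i)) \<and> q \<in> (SIGMA i : I. Field (B i))" if "(p, q) \<in> S" for p q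
    using that C_subset by (auto simp: block_sum_def intro: FieldI1 FieldI2)
  then have "Field S \<subseteq> (SIGMA i : I. Field (B i))"
    by (force simp: Field_def)
  ultimately show ?thesis by blast
qed

lemma trans_S: "trans S"
proof (rule transI)
  fix p q t assume *: "(p, q) \<in> S" "(q, t) \<in> S"
  obtain i x j y k z where [simp]: "p = (i, x)" "q = (j, y)" "t = (k, z)"
    by (metis surj_pair)
  have "trans (B i)" if "i \<in> I"
    using two_level_poset.partial_order[OF block[OF that]] by (simp add: order_on_defs)
  then show "(p, t) \<in> S"
    using * C_comp[of i j k] by (auto simp: block_sum_iff FieldI1 FieldI2 dest: transD)
qed

text \<open>A candidate \<open>m\<close> for the largest point strictly below \<open>p\<close> lies
  either in the block of \<open>p\<close> or in a block connected to it. In the first case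
  \<open>m\<close> would dominate two distinct lower points while being itself a lower point; in the
  second it would be the maximum of its block.\<close>

lemma no_down_beat_point_S: "no_down_beat_point S"
  unfolding no_down_beat_point_def
proof (rule notI, elim exE conjE)
  fix p m
  assume m: "(m, p) \<in> S" "m \<noteq> p" and max: "\<forall>q. (q, p) \<in> S \<and> q \<noteq> p \<longrightarrow> (q, m) \<in> S"
  obtain i z j y where [simp]: "m = (i, z)" "p = (j, y)"
    by (metis surj_pair)
  have irr: "(i, i) \<notin> C" "(i, j) \<in> C \<Longrightarrow> (j, i) \<notin> C" "(i, j) \<in> C \<Longrightarrow> i \<noteq> j"
    using C_comp by blast+
  have I: "i \<in> I" "j \<in> I" "z \<in> Field (B i)" "y \<in> Field (B j)"
    using m(1) Field_S FieldI1[OF m(1)] FieldI2[OF m(1)] by auto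
  interpret i: two_level_poset "B i" "L i" "U i" using block I by blast
  interpret j: two_level_poset "B j" "L j" "U j" using block I by blast
  show False
  proof (cases "i = j")
    case True
    then have zy: "(z, y) \<in> B j" "z \<noteq> y"
      using m irr by (auto simp: block_sum_iff)
    then have "z \<in> L j" "y \<in> U j"
      using j.strict by auto
    then obtain b c where bc: "b \<in> L j" "c \<in> L j" "b \<noteq> c" "(b, y) \<in> B j" "(c, y) \<in> B j"
      using j.two_below by blast
    then have "b \<noteq> y" "c \<noteq> y"
      using j.disjoint \<open>y \<in> U j\<close> by auto
    then have "(b, z) \<in> B j" "(c, z) \<in> B j"
      using max[rule_format, of "(j, b)"] max[rule_format, of "(j, c)"] bc I irr True
      by (auto simp: block_sum_iff)
    then show False
      using j.strict j.disjoint bc \<open>z \<in> L j\<close> by blast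
  next
    case False
    then have C: "(i, j) \<in> C"
      using m by (auto simp: block_sum_iff)
    obtain w where w: "w \<in> Field (B i)" "(w, z) \<notin> B i"
      using i.no_max by blast
    then have "((i, w), m) \<in> S"
      using max[rule_format, of "(i, w)"] C I False by (auto simp: block_sum_iff)
    then show False
      using w irr by (auto simp: block_sum_iff)
  qed
qed

lemma no_down_beat_point_converse_S: "no_down_beat_point (S\<inverse>)"
  using block_system.no_down_beat_point_S[OF dual] by (simp add: converse_block_sum)

text \<open>The order detects whether a block receives a connection: blocks have only two levels, so a
  three-element chain ending in \<open>p\<close> has to leave the block of \<open>p\<close>.\<close>

lemma chain_below_iff:
  assumes "p \<in> Field S"
  shows "(\<exists>a b. (a, b) \<in> S \<and> a \<noteq> b \<and> (b, p) \<in> S \<and> b \<noteq> p) \<longleftrightarrow> (\<exists>j. (j, fst p) \<in> C)"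
proof
  obtain k z where p [simp]: "p = (k, z)"
    by (metis surj_pair)
  have k: "k \<in> I" "z \<in> Field (B k)"
    using assms by (auto simp: Field_S)
  interpret k: two_level_poset "B k" "L k" "U k" using block k by blast
  show "\<exists>j. (j, fst p) \<in> C" if ex: "\<exists>a b. (a, b) \<in> S \<and> a \<noteq> b \<and> (b, p) \<in> S \<and> b \<noteq> p"
  proof (rule ccontr)
    assume no: "\<not> ?thesis"
    obtain i x j y where xy: "((i, x), (j, y)) \<in> S" "(i, x) \<noteq> (j, y)" "((j, y), p) \<in> S" "(j, y) \<noteq> p"
      using ex by (metis surj_pair)
    have jy: "j = k" "(y, z) \<in> B k" "y \<noteq> z"
      using xy(3,4) no by (auto simp: block_sum_iff)
    then have "(x, y) \<in> B k" "x \<noteq> y"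
      using xy(1,2) no by (auto simp: block_sum_iff)
    then show False
      using jy k.strict k.disjoint by blast
  qed
  show "\<exists>a b. (a, b) \<in> S \<and> a \<noteq> b \<and> (b, p) \<in> S \<and> b \<noteq> p" if ex: "\<exists>j. (j, fst p) \<in> C"
  proof -
    obtain j where j: "(j, k) \<in> C"
      using ex by auto
    then have "j \<in> I" "j \<noteq> k"
      using C_subset C_comp by auto
    interpret j: two_level_poset "B j" "L j" "U j" using block \<open>j \<in> I\<close> by blast
    obtain u v where uv: "u \<in> L j" "v \<in> U j" "(u, v) \<in> B j"
      using j.lower_hub j.upper_hub by blast
    then have "u \<noteq> v" using j.disjoint by auto
    have "((j, u), (j, v)) \<in> S" "((j, v), p) \<in> S" "(j, v) \<noteq> p"
      using uv j k \<open>j \<in> I\<close> \<open>j \<noteq> k\<close> by (auto simp: block_sum_iff FieldI2)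
    with \<open>u \<noteq> v\<close> show ?thesis
      by (metis prod.inject)
  qed
qed

section \<open>Automorphisms permute the blocks\<close>

lemma automorphism_upper_block:
  assumes f: "order_automorphism S f" and p: "p \<in> Field S" and j: "(j, fst p) \<in> C"
  shows "\<exists>j. (j, fst (f p)) \<in> C"
proof -
  have mono: "(f a, f b) \<in> S" if "(a, b) \<in> S" for a b
    using f that by (auto simp: order_automorphism_def FieldI1 FieldI2)
  have inj: "inj_on f (Field S)" and fp: "f p \<in> Field S"
    using f p by (auto simp: order_automorphism_def bij_betw_def)
  obtain a b where ab: "(a, b) \<in> S" "a \<noteq> b" "(b, p) \<in> S" "b \<noteq> p"
    using chain_below_iff[OF p] j by blast
  then have "f a \<noteq> f b" "f b \<noteq> f p"
    using inj by (auto simp: inj_on_eq_iff FieldI1 FieldI2)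
  then show ?thesis
    using chain_below_iff[OF fp] mono ab by blast
qed

text \<open>If the images lay in different blocks, a connection would lead from the block of
  \<open>f p\<close> to that of \<open>f q\<close>. The latter block receives a connection, so by
  the inverse automorphism the common block of \<open>p\<close> and \<open>q\<close> does too, and
  hence so does the block of \<open>f p\<close>. Two connections would then compose.\<close>

lemma automorphism_comparable:
  assumes f: "order_automorphism S f" and pq: "(p, q) \<in> S" "fst p = fst q"
  shows "fst (f p) = fst (f q)"
proof (rule ccontr)
  let ?g = "inv_into (Field S) f"
  assume ne: "fst (f p) \<noteq> fst (f q)"
  have F: "p \<in> Field S" "q \<in> Field S"
    using pq(1) by (auto intro: FieldI1 FieldI2)
  have b: "bij_betw f (Field S) (Field S)"
    using f by (simp add: order_automorphism_def)
  have fF: "f q \<in> Field S" and g: "?g (f q) = q"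
    using b F by (auto simp: bij_betw_apply bij_betw_inv_into_left)
  have "(f p, f q) \<in> S"
    using f pq F by (auto simp: order_automorphism_def)
  then have C: "(fst (f p), fst (f q)) \<in> C"
    using ne by (cases "f p"; cases "f q") (auto simp: block_sum_iff)
  then obtain j where "(j, fst q) \<in> C"
    using automorphism_upper_block[OF order_automorphism_inv_into[OF f] fF] g by auto
  then obtain j' where "(j', fst (f p)) \<in> C"
    using automorphism_upper_block[OF f F(1)] pq(2) by auto
  with C show False
    using C_comp by blast
qed

text \<open>Any point of the block reaches the upper hub \<open>v\<close> through comparabilities: a
  lower point directly, an upper point via the lower hub \<open>u\<close>.\<close>

lemma automorphism_same_block:
  assumes f: "order_automorphism S f" and "i \<in> I" "x \<in> Field (B i)" "y \<in> Field (B i)"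
  shows "fst (f (i, x)) = fst (f (i, y))"
proof -
  interpret i: two_level_poset "B i" "L i" "U i" using block assms by blast
  obtain u v where uv: "\<forall>y\<in>U i. (u, y) \<in> B i" "v \<in> U i" "\<forall>x\<in>L i. (x, v) \<in> B i"
    using i.lower_hub i.upper_hub by blast
  have eq: "fst (f (i, a)) = fst (f (i, b))" if "(a, b) \<in> B i" for a b
    using automorphism_comparable[OF f, of "(i, a)" "(i, b)"] that assms(2)
    by (simp add: block_sum_iff)
  have "fst (f (i, w)) = fst (f (i, v))" if "w \<in> Field (B i)" for w
    using that eq uv i.Field_eq by (metis Un_iff)
  then show ?thesis
    using assms(3,4) by simp
qed

lemma automorphism_block_map:
  assumes f: "order_automorphism S f"
  obtains \<pi> where "\<And>i. i \<in> I \<Longrightarrow> \<pi> i \<in> I"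
    and "\<And>i x. i \<in> I \<Longrightarrow> x \<in> Field (B i) \<Longrightarrow> fst (f (i, x)) = \<pi> i"
    and "\<And>i. i \<in> I \<Longrightarrow> bij_betw (\<lambda>x. snd (f (i, x))) (Field (B i)) (Field (B (\<pi> i)))"
    and "\<And>i x y. i \<in> I \<Longrightarrow> x \<in> Field (B i) \<Longrightarrow> y \<in> Field (B i) \<Longrightarrow>
           (snd (f (i, x)), snd (f (i, y))) \<in> B (\<pi> i) \<longleftrightarrow> (x, y) \<in> B i"
    and "\<And>i j. i \<in> I \<Longrightarrow> j \<in> I \<Longrightarrow> (\<pi> i, \<pi> j) \<in> C \<longleftrightarrow> (i, j) \<in> C"
proof -
  \<comment> \<open>The block map \<open>\<sigma>\<close> of the inverse automorphism is a left
    inverse of \<open>\<pi>\<close>, which makes \<open>\<pi>\<close> injective. The representatives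
    \<open>pt i\<close> are arbitrary, as all points of a block go to the same block.\<close>
  define g where "g = inv_into (Field S) f"
  define pt where "pt i = (SOME x. x \<in> Field (B i))" for i
  define \<pi> where "\<pi> i = fst (f (i, pt i))" for i
  define \<sigma> where "\<sigma> i = fst (g (i, pt i))" for i
  have g: "order_automorphism S g"
    using order_automorphism_inv_into[OF f] by (simp add: g_def)
  have bf: "bij_betw f (Field S) (Field S)"
    using f by (simp add: order_automorphism_def)
  have inv: "g (f p) = p" "f (g p) = p" "f p \<in> Field S" "g p \<in> Field S" if "p \<in> Field S" for p
    using that bf by (auto simp: g_def bij_betw_inv_into_left bij_betw_inv_into_right
        bij_betw_apply bij_betw_apply[OF bij_betw_inv_into])
  have pt: "pt i \<in> Field (B i)" if "i \<in> I" for i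
  proof -
    interpret two_level_poset "B i" "L i" "U i" using block that by blast
    have "\<exists>x. x \<in> Field (B i)"
      using lower_hub Field_eq by auto
    then show ?thesis
      unfolding pt_def by (rule someI_ex)
  qed
  have \<pi>: "fst (f (i, x)) = \<pi> i" and \<sigma>: "fst (g (i, x)) = \<sigma> i"
    if "i \<in> I" "x \<in> Field (B i)" for i x
    using automorphism_same_block[OF f that(1) that(2) pt]
      automorphism_same_block[OF g that(1) that(2) pt] that(1) by (auto simp: \<pi>_def \<sigma>_def)
  have inF: "(i, x) \<in> Field S \<longleftrightarrow> i \<in> I \<and> x \<in> Field (B i)" for i x
    by (auto simp: Field_S)
  have fI: "\<pi> i \<in> I" "snd (f (i, x)) \<in> Field (B (\<pi> i))" "f (i, x) = (\<pi> i, snd (f (i, x)))"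
    if "i \<in> I" "x \<in> Field (B i)" for i x
    using inv(3)[of "(i, x)"] \<pi>[OF that] that by (auto simp: inF Field_S mem_Times_iff split: prod.splits)
  have gI: "\<sigma> i \<in> I" "snd (g (i, x)) \<in> Field (B (\<sigma> i))" "g (i, x) = (\<sigma> i, snd (g (i, x)))"
    if "i \<in> I" "x \<in> Field (B i)" for i x
    using inv(4)[of "(i, x)"] \<sigma>[OF that] that by (auto simp: inF Field_S mem_Times_iff split: prod.splits)
  have \<sigma>\<pi>: "\<sigma> (\<pi> i) = i" if "i \<in> I" for i
    using \<sigma>[OF fI(1,2)[OF that pt[OF that]]] fI(3)[OF that pt[OF that]] inv(1)[of "(i, pt i)"]
      that pt by (simp add: inF)
  have irr: "(i, i) \<notin> C" for i
    using C_comp by blast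
  have le: "(f p, f q) \<in> S \<longleftrightarrow> (p, q) \<in> S" if "p \<in> Field S" "q \<in> Field S" for p q
    using f that by (simp add: order_automorphism_def)
  show thesis
  proof
    show "\<pi> i \<in> I" if "i \<in> I" for i
      using fI(1) pt that by blast
    show "fst (f (i, x)) = \<pi> i" if "i \<in> I" "x \<in> Field (B i)" for i x
      using \<pi> that .
    show "bij_betw (\<lambda>x. snd (f (i, x))) (Field (B i)) (Field (B (\<pi> i)))" if i: "i \<in> I" for i
    proof (rule bij_betw_byWitness[of _ "\<lambda>y. snd (g (\<pi> i, y))"])
      have \<pi>i: "\<pi> i \<in> I" using fI(1) pt i by blast
      show "\<forall>x\<in>Field (B i). snd (g (\<pi> i, snd (f (i, x)))) = x"
        using fI(3)[OF i] inv(1) i by (metis inF snd_conv)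
      show "\<forall>y\<in>Field (B (\<pi> i)). snd (f (i, snd (g (\<pi> i, y)))) = y"
        using gI(3)[OF \<pi>i] inv(2) \<pi>i \<sigma>\<pi>[OF i] by (metis inF snd_conv)
      show "(\<lambda>x. snd (f (i, x))) ` Field (B i) \<subseteq> Field (B (\<pi> i))"
        using fI(2) i by auto
      show "(\<lambda>y. snd (g (\<pi> i, y))) ` Field (B (\<pi> i)) \<subseteq> Field (B i)"
        using gI(2)[OF \<pi>i] \<sigma>\<pi>[OF i] by auto
    qed
    show "(snd (f (i, x)), snd (f (i, y))) \<in> B (\<pi> i) \<longleftrightarrow> (x, y) \<in> B i"
      if "i \<in> I" "x \<in> Field (B i)" "y \<in> Field (B i)" for i x y
    proof -
      have "((\<pi> i, snd (f (i, x))), (\<pi> i, snd (f (i, y)))) \<in> S \<longleftrightarrow> ((i, x), (i, y)) \<in> S"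
        using le[of "(i, x)" "(i, y)"] fI(3) that by (metis inF)
      then show ?thesis
        using that fI(1)[OF that(1,2)] irr by (simp add: block_sum_iff)
    qed
    show "(\<pi> i, \<pi> j) \<in> C \<longleftrightarrow> (i, j) \<in> C" if "i \<in> I" "j \<in> I" for i j
    proof (cases "i = j")
      case False
      \<comment> \<open>Points of distinct blocks are comparable only through a connection, and a
        connection compares all of them, so one pair of points tests for it.\<close>
      then have "\<pi> i \<noteq> \<pi> j"
        using \<sigma>\<pi> that by metis
      have "((\<pi> i, snd (f (i, pt i))), (\<pi> j, snd (f (j, pt j)))) \<in> S \<longleftrightarrow> ((i, pt i), (j, pt j)) \<in> S"
        using le[of "(i, pt i)" "(j, pt j)"] fI(3) that pt by (metis inF)
      then show ?thesis
        using False \<open>\<pi> i \<noteq> \<pi> j\<close> fI(2) that pt by (simp add: block_sum_iff)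
    qed (use irr in simp)
  qed
qed

end

section \<open>Rigidity of \<open>F\<^sub>k\<close>\<close>

text \<open>A longest chain ending in \<open>x\<close> can be prolonged by \<open>y\<close>.\<close>

lemma poset_level_strict_mono:
  assumes "Partial_order r" "finite (Field r)" "(x, y) \<in> r" "x \<noteq> y"
  shows "poset_level r x < poset_level r y"
proof -
  let ?R = "\<lambda>a b. (a, b) \<in> r \<and> a \<noteq> b"
  let ?C = "\<lambda>x xs. xs \<noteq> [] \<and> set xs \<subseteq> Field r \<and> last xs = x \<and> sorted_wrt ?R xs"
  have tr: "?R a c" if "?R a b" "?R b c" for a b c
    using that assms(1) unfolding order_on_defs by (metis antisymD transD)
  \<comment> \<open>Strict chains have no repetitions, so their length is at most the number of
    points; this gives \<open>Max\<close> its meaning.\<close>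
  have fin: "finite {length xs | xs. ?C z xs}" for z
  proof (rule finite_subset)
    have "distinct xs" if "sorted_wrt ?R xs" for xs
      using that by (induction xs) auto
    then show "{length xs | xs. ?C z xs} \<subseteq> {..card (Field r)}"
      using assms(2) by (auto simp: card_mono simp flip: distinct_card)
  qed simp
  have "?C x [x]"
    using assms(3) by (auto intro: FieldI1)
  then have "{length xs | xs. ?C x xs} \<noteq> {}"
    by blast
  from Max_in[OF fin this] obtain xs where xs: "poset_level r x = length xs" "?C x xs"
    unfolding poset_level_def by blast
  have "?R a y" if "a \<in> set xs" for a
  proof -
    obtain ys where ys: "xs = ys @ [x]"
      using xs(2) by (metis append_butlast_last_id)
    then have "a = x \<or> ?R a x"
      using xs(2) that by (auto simp: sorted_wrt_append)
    then show ?thesis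
      using tr assms(3,4) by blast
  qed
  then have "?C y (xs @ [y])"
    using xs(2) assms(3) by (auto simp: sorted_wrt_append intro: FieldI2)
  then have "length (xs @ [y]) \<le> poset_level r y"
    unfolding poset_level_def by (intro Max_ge fin) blast
  then show ?thesis
    using xs(1) by simp
qed

section \<open>Degrees and adjacency in \<open>F k\<close>\<close>

lemma is_F_global:
  assumes "is_F k r"
  shows "Partial_order r" "finite (Field r)" "card (Field r) = 2 * k + 8"
    "Field r = level_set r 1 \<union> level_set r 2"
proof -
  note D = assms[unfolded is_F_def]
  note D2 = D[THEN conjunct2] note D3 = D2[THEN conjunct2] note D4 = D3[THEN conjunct2]
  show "Partial_order r" "finite (Field r)" "card (Field r) = 2 * k + 8"
      "Field r = level_set r 1 \<union> level_set r 2"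
    by (rule D[THEN conjunct1] D2[THEN conjunct1] D3[THEN conjunct1] D4[THEN conjunct1])+
qed

lemma is_F_level:
  assumes F: "is_F k r" and l: "l \<in> {1, 2}"
  shows "card (level_set r l) = k + 4"
    "card {x \<in> level_set r l. hasse_degree r x = 2} = 2"
    "\<forall>i\<in>{3..k + 4}. card {x \<in> level_set r l. hasse_degree r x = i} = 1"
    "\<exists>a b. a \<noteq> b \<and> {x \<in> level_set r l. hasse_degree r x = 2} = {a, b} \<and>
           (\<exists>u\<in>level_set r (3 - l). hasse_degree r u = 2 \<and> hasse_adj r a u) \<and>
           (\<exists>u\<in>level_set r (3 - l). hasse_degree r u = k + 4 \<and> hasse_adj r a u) \<and>
           (\<exists>u\<in>level_set r (3 - l). hasse_degree r u = k + 3 \<and> hasse_adj r b u) \<and>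
           (\<exists>u\<in>level_set r (3 - l). hasse_degree r u = k + 4 \<and> hasse_adj r b u)"
proof -
  note D = bspec[OF F[unfolded is_F_def, THEN conjunct2, THEN conjunct2, THEN conjunct2,
      THEN conjunct2, THEN conjunct2] l]
  note D2 = D[THEN conjunct2] note D3 = D2[THEN conjunct2]
  show "card (level_set r l) = k + 4"
    by (rule D[THEN conjunct1])
  show "card {x \<in> level_set r l. hasse_degree r x = 2} = 2"
    by (rule D2[THEN conjunct1])
  show "\<forall>i\<in>{3..k + 4}. card {x \<in> level_set r l. hasse_degree r x = i} = 1"
    by (rule D3[THEN conjunct1])
qed (rule F[unfolded is_F_def, THEN conjunct2, THEN conjunct2, THEN conjunct2,
      THEN conjunct2, THEN conjunct2, THEN bspec, OF l, THEN conjunct2, THEN conjunct2, THEN conjunct2])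

lemma is_F_strict:
  assumes F: "is_F k r" and xy: "(x, y) \<in> r" "x \<noteq> y"
  shows "x \<in> level_set r 1" "y \<in> level_set r 2"
proof -
  have "poset_level r x < poset_level r y"
    using xy is_F_global[OF F] by (intro poset_level_strict_mono)
  moreover have "x \<in> level_set r 1 \<union> level_set r 2" "y \<in> level_set r 1 \<union> level_set r 2"
    using is_F_global(4)[OF F] FieldI1[OF xy(1)] FieldI2[OF xy(1)] by blast+
  ultimately show "x \<in> level_set r 1" "y \<in> level_set r 2"
    by (auto simp: level_set_def)
qed

lemma level_set_disjoint: "level_set r 1 \<inter> level_set r 2 = {}"
  by (auto simp: level_set_def)

text \<open>With only two levels nothing fits strictly between two points, so every strict relation
  is a Hasse edge.\<close>

lemma is_F_hasse_adj:
  assumes F: "is_F k r"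
  shows "hasse_adj r x y \<longleftrightarrow> x \<noteq> y \<and> ((x, y) \<in> r \<or> (y, x) \<in> r)"
proof -
  have "hasse_edges r = r - Id"
    using is_F_strict[OF F] level_set_disjoint[of r] by (auto simp: hasse_edges_def) blast
  then show ?thesis
    by (auto simp: hasse_adj_def)
qed

lemma is_F_hasse_adj_level:
  assumes F: "is_F k r" and l: "l \<in> {1, 2}" and "x \<in> level_set r l" "hasse_adj r x y"
  shows "y \<in> level_set r (3 - l)"
proof -
  have "x \<in> level_set r 1 \<and> y \<in> level_set r 2 \<or> y \<in> level_set r 1 \<and> x \<in> level_set r 2"
    using assms(4) is_F_strict[OF F] unfolding is_F_hasse_adj[OF F] by blast
  then show ?thesis
    using l assms(3) by (auto simp: level_set_def)
qed

text \<open>The prescribed degrees already account for \<open>2 + (k + 2) = k + 4\<close> vertices,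
  which is the whole level, so no other degree occurs.\<close>

lemma is_F_degree:
  assumes F: "is_F k r" and l: "l \<in> {1, 2}" and x: "x \<in> level_set r l"
  shows "hasse_degree r x \<in> {2..k + 4}"
proof -
  define D where "D i = {x \<in> level_set r l. hasse_degree r x = i}" for i
  have card: "card (level_set r l) = k + 4" "card (D 2) = 2" "\<And>i. i \<in> {3..k + 4} \<Longrightarrow> card (D i) = 1"
    using is_F_level[OF F l] by (auto simp: D_def)
  then have fin: "finite (level_set r l)"
    using card.infinite by fastforce
  have "card (\<Union>i\<in>{2..k + 4}. D i) = (\<Sum>i\<in>{2..k + 4}. card (D i))"
    using fin by (intro card_UN_disjoint) (auto simp: D_def)
  also have "\<dots> = card (D 2) + (\<Sum>i\<in>{3..k + 4}. card (D i))"
    by (subst sum.atLeast_Suc_atMost) (simp_all add: numeral_3_eq_3 numeral_2_eq_2)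
  also have "\<dots> = card (level_set r l)"
    using card by simp
  finally have "(\<Union>i\<in>{2..k + 4}. D i) = level_set r l"
    using fin by (intro card_subset_eq) (auto simp: D_def)
  then show ?thesis
    using x by (auto simp: D_def)
qed

lemma is_F_two_neighbours:
  assumes F: "is_F k r" and l: "l \<in> {1, 2}" and x: "x \<in> level_set r l"
  shows "\<exists>y\<in>level_set r (3 - l). \<exists>z\<in>level_set r (3 - l). y \<noteq> z \<and> hasse_adj r x y \<and> hasse_adj r x z"
proof -
  have "2 \<le> card {y. hasse_adj r x y}"
    using is_F_degree[OF assms] by (simp add: hasse_degree_def)
  then obtain y z where "y \<noteq> z" "hasse_adj r x y" "hasse_adj r x z"
    using card_le_Suc0_iff_eq[of "{y. hasse_adj r x y}"]
    by (metis (mono_tags) card.infinite mem_Collect_eq not_less_eq_eq numeral_2_eq_2 zero_le)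
  then show ?thesis
    using is_F_hasse_adj_level[OF assms] by blast
qed

text \<open>The vertex of degree \<open>k + 4\<close> has as many neighbours as the opposite level
  has points.\<close>

lemma is_F_hub:
  assumes F: "is_F k r" and l: "l \<in> {1, 2}"
  shows "\<exists>u\<in>level_set r l. \<forall>y\<in>level_set r (3 - l). hasse_adj r u y"
proof -
  have "card {x \<in> level_set r l. hasse_degree r x = k + 4} = 1"
    using is_F_level(3)[OF F l] by simp
  then obtain u where u: "u \<in> level_set r l" "hasse_degree r u = k + 4"
    by (metis (mono_tags, lifting) card_1_singletonE insertI1 mem_Collect_eq)
  have l': "3 - l \<in> {1, 2}" using l by auto
  have c: "card (level_set r (3 - l)) = k + 4"
    using F l' by (rule is_F_level(1))
  have "{y. hasse_adj r u y} = level_set r (3 - l)"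
  proof (rule card_subset_eq)
    show "finite (level_set r (3 - l))"
      using c card.infinite by fastforce
    show "{y. hasse_adj r u y} \<subseteq> level_set r (3 - l)"
      using is_F_hasse_adj_level[OF F l u(1)] by blast
  qed (use u(2) c in \<open>simp add: hasse_degree_def\<close>)
  then show ?thesis
    using u(1) by blast
qed

lemma is_F_two_level_poset:
  assumes F: "is_F k r"
  shows "two_level_poset r (level_set r 1) (level_set r 2)"
proof
  show "Partial_order r" "Field r = level_set r 1 \<union> level_set r 2"
    by (rule is_F_global[OF F])+
  note adj = is_F_hasse_adj[OF F] and str = is_F_strict[OF F] and dis = level_set_disjoint[of r]
  show "level_set r 1 \<inter> level_set r 2 = {}"
    by (rule dis)
  show "x \<in> level_set r 1 \<and> y \<in> level_set r 2" if "(x, y) \<in> r" "x \<noteq> y" for x y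
    using str that by blast
  have up: "hasse_adj r x y \<longleftrightarrow> (x, y) \<in> r" if "x \<in> level_set r 1" "y \<in> level_set r 2" for x y
    using that adj str dis by blast
  then have down: "hasse_adj r y x \<longleftrightarrow> (x, y) \<in> r" if "x \<in> level_set r 1" "y \<in> level_set r 2" for x y
    using that by (auto simp: hasse_adj_def)
  show "\<exists>y\<in>level_set r 2. \<exists>z\<in>level_set r 2. y \<noteq> z \<and> (x, y) \<in> r \<and> (x, z) \<in> r"
    if "x \<in> level_set r 1" for x
    using is_F_two_neighbours[OF F, of 1 x] that by (auto simp: up)
  show "\<exists>y\<in>level_set r 1. \<exists>z\<in>level_set r 1. y \<noteq> z \<and> (y, x) \<in> r \<and> (z, x) \<in> r"
    if "x \<in> level_set r 2" for x
    using is_F_two_neighbours[OF F, of 2 x] that by (auto simp: down)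
  show "\<exists>u\<in>level_set r 1. \<forall>y\<in>level_set r 2. (u, y) \<in> r"
    using is_F_hub[OF F, of 1] by (auto simp: up)
  show "\<exists>v\<in>level_set r 2. \<forall>x\<in>level_set r 1. (x, v) \<in> r"
    using is_F_hub[OF F, of 2] by (auto simp: down)
qed

lemma is_F_bottom_top:
  assumes F: "is_F k r"
  shows "bottom_level r = level_set r 1" "top_level r = level_set r 2"
proof -
  interpret two_level_poset r "level_set r 1" "level_set r 2"
    using F by (rule is_F_two_level_poset)
  obtain u v where "u \<in> level_set r 1" "v \<in> level_set r 2"
    using lower_hub upper_hub by blast
  then have "{1, 2} \<subseteq> poset_level r ` Field r"
    unfolding level_set_def by (blast intro: sym)
  moreover have "poset_level r ` Field r \<subseteq> {1, 2}"
    by (subst Field_eq) (auto simp: level_set_def)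
  ultimately have "poset_level r ` Field r = {1, 2}"
    by blast
  then show "top_level r = level_set r 2"
    by (simp add: top_level_def numeral_2_eq_2)
qed (simp add: bottom_level_def)

text \<open>Automorphisms preserve levels and degrees, which singles out every vertex except the two of
  degree \<open>2\<close> on each level; of these only one is adjacent to another vertex of degree \<open>2\<close>.\<close>

lemma is_F_rigid:
  assumes F: "is_F k r" and f: "order_automorphism r f" and x: "x \<in> Field r"
  shows "f x = x"
proof -
  interpret two_level_poset r "level_set r 1" "level_set r 2"
    using F by (rule is_F_two_level_poset)
  note adj = is_F_hasse_adj[OF F]
  have b: "bij_betw f (Field r) (Field r)"
    and le: "\<And>x y. x \<in> Field r \<Longrightarrow> y \<in> Field r \<Longrightarrow> (f x, f y) \<in> r \<longleftrightarrow> (x, y) \<in> r"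
    using f by (auto simp: order_automorphism_def)
  have inj: "f x = f y \<longleftrightarrow> x = y" if "x \<in> Field r" "y \<in> Field r" for x y
    using that b by (auto simp: bij_betw_def inj_on_eq_iff)
  have adj_F: "x \<in> Field r \<and> y \<in> Field r" if "hasse_adj r x y" for x y
    using that unfolding adj by (auto intro: FieldI1 FieldI2)
  have adj_f: "hasse_adj r (f x) (f y) \<longleftrightarrow> hasse_adj r x y" if "x \<in> Field r" "y \<in> Field r" for x y
    using that by (simp add: adj inj le)
  have deg: "hasse_degree r (f x) = hasse_degree r x" if x: "x \<in> Field r" for x
  proof -
    have "{y. hasse_adj r (f x) y} = f ` {y. hasse_adj r x y}"
    proof (intro subset_antisym subsetI)
      fix z assume z: "z \<in> {y. hasse_adj r (f x) y}"
      then obtain y where "y \<in> Field r" "z = f y"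
        using adj_F b by (metis bij_betw_imp_surj_on imageE mem_Collect_eq)
      then show "z \<in> f ` {y. hasse_adj r x y}"
        using z adj_f x by auto
    qed (use adj_f adj_F x in auto)
    moreover have "inj_on f {y. hasse_adj r x y}"
      using inj adj_F by (auto simp: inj_on_def)
    ultimately show ?thesis
      by (simp add: hasse_degree_def card_image)
  qed
  \<comment> \<open>Lower points are those with something strictly above them, a property that
    automorphisms preserve.\<close>
  have lev1: "f x \<in> level_set r 1" if x: "x \<in> level_set r 1" for x
  proof -
    obtain y where y: "y \<in> level_set r 2" "(x, y) \<in> r"
      using two_above[OF x] by blast
    then have "x \<noteq> y" "x \<in> Field r" "y \<in> Field r"
      using x disjoint Field_eq by auto
    then show ?thesis
      using strict[of "f x" "f y"] y by (simp add: le inj)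
  qed
  have lev2: "f x \<in> level_set r 2" if x: "x \<in> level_set r 2" for x
  proof -
    obtain y where y: "y \<in> level_set r 1" "(y, x) \<in> r"
      using two_below[OF x] by blast
    then have "x \<noteq> y" "x \<in> Field r" "y \<in> Field r"
      using x disjoint Field_eq by auto
    then show ?thesis
      using strict[of "f y" "f x"] y by (simp add: le inj)
  qed
  obtain l where l: "l \<in> {1, 2}" "x \<in> level_set r l"
    using x Field_eq by auto
  have lF: "y \<in> Field r" if "y \<in> level_set r m" for y m
    using that by (simp add: level_set_def)
  define D where "D i = {x \<in> level_set r l. hasse_degree r x = i}" for i
  have fD: "f y \<in> D i" if "y \<in> D i" for y i
    using that l lev1 lev2 deg lF by (auto simp: D_def)
  show ?thesis
  proof (cases "hasse_degree r x = 2")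
    case False
    then have i: "hasse_degree r x \<in> {3..k + 4}"
      using is_F_degree[OF F l] by auto
    then have "card (D (hasse_degree r x)) = 1"
      using is_F_level(3)[OF F l(1)] i by (simp add: D_def)
    moreover have "x \<in> D (hasse_degree r x)"
      using l by (simp add: D_def)
    ultimately show ?thesis
      using fD by (metis card_1_singletonE singletonD)
  next
    case True
    obtain a b where ab: "a \<noteq> b" "D 2 = {a, b}"
      and a: "\<exists>u\<in>level_set r (3 - l). hasse_degree r u = 2 \<and> hasse_adj r a u"
      and b1: "\<exists>u\<in>level_set r (3 - l). hasse_degree r u = k + 3 \<and> hasse_adj r b u"
      and b2: "\<exists>u\<in>level_set r (3 - l). hasse_degree r u = k + 4 \<and> hasse_adj r b u"
      using is_F_level(4)[OF F l(1)] unfolding D_def[symmetric] by (elim exE conjE) (rule that)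
    obtain u where u: "hasse_degree r u = 2" "hasse_adj r a u"
      using a by blast
    obtain v w where vw: "hasse_degree r v = k + 3" "hasse_adj r b v"
      "hasse_degree r w = k + 4" "hasse_adj r b w"
      using b1 b2 by blast
    have "hasse_degree r b = 2"
      using ab(2) by (auto simp: D_def)
    moreover have "v \<noteq> w" using vw by auto
    \<comment> \<open>Since \<open>b\<close> has degree 2, \<open>v\<close> and \<open>w\<close> are
      its only neighbours, and their degrees are at least 3. So \<open>b\<close> cannot be
      \<open>f a\<close>, which is adjacent to the degree-2 vertex \<open>f u\<close>.\<close>
    ultimately have "{v, w} = {y. hasse_adj r b y}"
      using vw by (intro card_subset_eq) (auto simp: hasse_degree_def intro: card_ge_0_finite)
    moreover have "hasse_degree r (f u) = 2" "hasse_adj r (f a) (f u)"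
      using u adj_F[OF u(2)] deg adj_f by auto
    ultimately have "f u \<in> {v, w}" if "f a = b"
      using that by blast
    then have "f a \<noteq> b"
      using vw \<open>hasse_degree r (f u) = 2\<close> by auto
    moreover have "f a \<in> {a, b}" "f b \<in> {a, b}"
      using fD ab(2) by auto
    ultimately have "f a = a" "f b = b"
      using inj[of a b] ab adj_F[OF u(2)] adj_F[OF vw(2)] by auto
    moreover have "x \<in> {a, b}"
      using l True ab(2) by (auto simp: D_def)
    ultimately show ?thesis
      by auto
  qed
qed

lemma
  assumes B: "\<And>i. i \<in> I \<Longrightarrow> is_F (c i) (B i)" and C: "C \<subseteq> I \<times> I"
    and C_comp: "\<And>i j k. (i, j) \<in> C \<Longrightarrow> (j, k) \<notin> C"
  shows is_F_block_system: "block_system I B (\<lambda>i. level_set (B i) 1) (\<lambda>i. level_set (B i) 2) C"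
    and block_poset_eq_block_sum: "block_poset I B C = block_sum I B C"
proof -
  show sys: "block_system I B (\<lambda>i. level_set (B i) 1) (\<lambda>i. level_set (B i) 2) C"
    by (rule block_system.intro) (use assms is_F_two_level_poset in \<open>blast+\<close>)
  then interpret block_system I B "\<lambda>i. level_set (B i) 1" "\<lambda>i. level_set (B i) 2" C .
  define R where "R = {((i, x), (i, y)) | i x y. i \<in> I \<and> (x, y) \<in> B i} \<union>
      {((i, x), (j, y)) | i x j y. (i, j) \<in> C \<and> x \<in> top_level (B i) \<and> y \<in> bottom_level (B j)}"
  have lev: "level_set r l \<subseteq> Field r" for l and r :: "'b rel"
    by (auto simp: level_set_def)
  have "R \<subseteq> S"
    using lev unfolding R_def block_sum_def top_level_def bottom_level_def by blast
  then have "R\<^sup>+ \<subseteq> S"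
    using trans_S by (metis trancl_id trancl_mono_subset)
  moreover have "S \<subseteq> R\<^sup>+"
  proof (rule subrelI)
    fix p q assume pq: "(p, q) \<in> S"
    obtain i x j y where [simp]: "p = (i, x)" "q = (j, y)"
      by (metis surj_pair)
    show "(p, q) \<in> R\<^sup>+"
    proof (cases "(i, j) \<in> C")
      case True
      then have ij: "i \<in> I" "j \<in> I"
        using C by auto
      interpret i: two_level_poset "B i" "level_set (B i) 1" "level_set (B i) 2"
        using block ij by blast
      interpret j: two_level_poset "B j" "level_set (B j) 1" "level_set (B j) 2"
        using block ij by blast
      have xy: "x \<in> Field (B i)" "y \<in> Field (B j)"
        using pq ij FieldI1[OF pq] FieldI2[OF pq] by (auto simp: Field_S)
      \<comment> \<open>A relation across a connection factors as a climb to the top level of block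
        \<open>i\<close>, one added edge, and a climb from the bottom level of block
        \<open>j\<close>.\<close>
      obtain x' where x': "(x, x') \<in> B i" "x' \<in> level_set (B i) 2"
        using xy(1) i.two_above i.refl i.Field_eq by (metis Un_iff)
      obtain y' where y': "(y', y) \<in> B j" "y' \<in> level_set (B j) 1"
        using xy(2) j.two_below j.refl j.Field_eq by (metis Un_iff)
      have "(p, (i, x')) \<in> R" "((i, x'), (j, y')) \<in> R" "((j, y'), q) \<in> R"
        using True ij x' y' is_F_bottom_top[OF B[OF ij(1)]] is_F_bottom_top[OF B[OF ij(2)]]
        by (auto simp: R_def)
      then show ?thesis
        by (meson r_into_trancl trancl_trans)
    next
      case False
      then have "(p, q) \<in> R"
        using pq by (auto simp: R_def block_sum_iff)
      then show ?thesis by blast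
    qed
  qed
  ultimately show "block_poset I B C = S"
    unfolding block_poset_def R_def[symmetric] by blast
qed

section \<open>Automorphisms of \<open>X(G, S)\<close>\<close>

locale cayley_space = group G for G :: "('g, 'm) monoid_scheme" (structure) +
  fixes n :: nat and s :: "nat \<Rightarrow> 'g" and F :: "nat \<Rightarrow> 'p rel"
  assumes finite_carrier: "finite (carrier G)"
    and s_carrier: "k \<in> {1..n} \<Longrightarrow> s k \<in> carrier G"
    and generated: "generate G (s ` {1..n}) = carrier G"
    and F: "is_F k (F k)"
begin

abbreviation "I \<equiv> X_blocks G n s"
abbreviation "C \<equiv> X_connections G n s"
abbreviation "B \<equiv> \<lambda>i :: 'g block. F (block_index n i)"
abbreviation "X \<equiv> X_poset F G n s"

lemma X_connections_iff:
  "(i, j) \<in> C \<longleftrightarrow> (\<exists>k a. k \<in> {1..n} \<and> a \<in> carrier G \<and>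
     (j = StartBlock (k, a, s k \<otimes> a) \<and> (i = EdgeBlock (k, a, s k \<otimes> a) \<or> i = VertexBlock a) \<or>
      j = EndBlock (k, a, s k \<otimes> a) \<and> (i = EdgeBlock (k, a, s k \<otimes> a) \<or> i = VertexBlock (s k \<otimes> a))))"
  by (auto simp: X_connections_def cayley_edges_def)

lemma X_blocks_iff:
  "VertexBlock a \<in> I \<longleftrightarrow> a \<in> carrier G"
  "EdgeBlock (k, a, b) \<in> I \<longleftrightarrow> k \<in> {1..n} \<and> a \<in> carrier G \<and> b = s k \<otimes> a"
  "StartBlock (k, a, b) \<in> I \<longleftrightarrow> k \<in> {1..n} \<and> a \<in> carrier G \<and> b = s k \<otimes> a"
  "EndBlock (k, a, b) \<in> I \<longleftrightarrow> k \<in> {1..n} \<and> a \<in> carrier G \<and> b = s k \<otimes> a"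
  by (auto simp: X_blocks_def cayley_edges_def)

lemma X_connections_blocks: "C \<subseteq> I \<times> I"
  using s_carrier by (auto simp: X_connections_iff X_blocks_iff)

lemma X_connections_no_comp: "(i, j) \<in> C \<Longrightarrow> (j, k) \<notin> C"
  by (auto simp: X_connections_iff)

sublocale block_system I B "\<lambda>i. level_set (B i) 1" "\<lambda>i. level_set (B i) 2" C
  rewrites block_sum_X: "block_sum I B C = X"
proof -
  note hyps = F X_connections_blocks X_connections_no_comp
  show "block_system I B (\<lambda>i. level_set (B i) 1) (\<lambda>i. level_set (B i) 2) C"
    using hyps by (rule is_F_block_system)
  show "block_sum I B C = X"
    unfolding X_poset_def using block_poset_eq_block_sum[of I _ B C, OF hyps] by simp
qed

lemma partial_order_X: "Partial_order X"
  using s_carrier by (intro Partial_order_X_poset(1) F is_group) auto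

lemma finite_X: "finite (Field X)"
proof -
  have "cayley_edges G n s = (\<lambda>(k, g). (k, g, s k \<otimes> g)) ` ({1..n} \<times> carrier G)"
    by (auto simp: cayley_edges_def)
  then have "finite I"
    using finite_carrier by (simp add: X_blocks_def)
  then show ?thesis
    unfolding Field_S using is_F_global(2)[OF F] by blast
qed

section \<open>The action of \<open>G\<close> by right translations\<close>

fun translate_block :: "'g \<Rightarrow> 'g block \<Rightarrow> 'g block" where
  "translate_block c (VertexBlock a) = VertexBlock (a \<otimes> c)"
| "translate_block c (EdgeBlock (k, a, b)) = EdgeBlock (k, a \<otimes> c, b \<otimes> c)"
| "translate_block c (StartBlock (k, a, b)) = StartBlock (k, a \<otimes> c, b \<otimes> c)"
| "translate_block c (EndBlock (k, a, b)) = EndBlock (k, a \<otimes> c, b \<otimes> c)"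

text \<open>Leaving the second component alone is legitimate because translated blocks keep their
  index and so carry the same copy of \<open>F k\<close>.\<close>

definition translate :: "'g \<Rightarrow> 'g block \<times> 'p \<Rightarrow> 'g block \<times> 'p" where
  "translate c = map_prod (translate_block c) id"

lemma block_index_translate [simp]: "block_index n (translate_block c i) = block_index n i"
  by (induction c i rule: translate_block.induct) auto

lemma X_blocks_cases [consumes 1, case_names Vertex Edge Start End]:
  assumes "i \<in> I"
  obtains a where "i = VertexBlock a" "a \<in> carrier G"
  | k a where "i = EdgeBlock (k, a, s k \<otimes> a)" "k \<in> {1..n}" "a \<in> carrier G"
  | k a where "i = StartBlock (k, a, s k \<otimes> a)" "k \<in> {1..n}" "a \<in> carrier G"
  | k a where "i = EndBlock (k, a, s k \<otimes> a)" "k \<in> {1..n}" "a \<in> carrier G"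
  using assms unfolding X_blocks_def cayley_edges_def by blast

lemma translate_block_X_blocks: "c \<in> carrier G \<Longrightarrow> i \<in> I \<Longrightarrow> translate_block c i \<in> I"
  by (erule X_blocks_cases) (simp_all add: X_blocks_iff m_assoc s_carrier)

text \<open>Associativity: right multiplication commutes with left multiplication by
  \<open>s k\<close>, so edges go to edges of the same colour.\<close>

lemma translate_block_X_connections:
  assumes "c \<in> carrier G" "(i, j) \<in> C"
  shows "(translate_block c i, translate_block c j) \<in> C"
proof -
  obtain k a where ka: "k \<in> {1..n}" "a \<in> carrier G"
     "j = StartBlock (k, a, s k \<otimes> a) \<and> (i = EdgeBlock (k, a, s k \<otimes> a) \<or> i = VertexBlock a) \<or>
      j = EndBlock (k, a, s k \<otimes> a) \<and> (i = EdgeBlock (k, a, s k \<otimes> a) \<or> i = VertexBlock (s k \<otimes> a))"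
    using assms(2) unfolding X_connections_iff by blast
  then show ?thesis
    unfolding X_connections_iff using assms(1) s_carrier[OF ka(1)]
    by (intro exI[of _ k] exI[of _ "a \<otimes> c"]) (auto simp: m_assoc)
qed

lemma translate_block_mult:
  assumes "c \<in> carrier G" "d \<in> carrier G" "i \<in> I"
  shows "translate_block c (translate_block d i) = translate_block (d \<otimes> c) i"
  using assms(3,1,2) by (cases rule: X_blocks_cases) (simp_all add: m_assoc s_carrier)

lemma translate_block_one: "i \<in> I \<Longrightarrow> translate_block \<one> i = i"
  by (erule X_blocks_cases) (simp_all add: s_carrier)

lemma translate_mult:
  assumes "c \<in> carrier G" "d \<in> carrier G" "p \<in> Field X"
  shows "translate c (translate d p) = translate (d \<otimes> c) p"
  using assms by (auto simp: translate_def Field_S translate_block_mult)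

lemma translate_one: "p \<in> Field X \<Longrightarrow> translate \<one> p = p"
  by (auto simp: translate_def Field_S translate_block_one)

lemma translate_mono:
  assumes "c \<in> carrier G" "(p, q) \<in> X"
  shows "(translate c p, translate c q) \<in> X"
proof -
  obtain i x j y where "p = (i, x)" "q = (j, y)"
    by (metis surj_pair)
  then show ?thesis
    using assms translate_block_X_blocks translate_block_X_connections
    by (auto simp: translate_def block_sum_iff simp flip: block_sum_X)
qed

lemma order_automorphism_translate:
  assumes "c \<in> carrier G"
  shows "order_automorphism X (translate c)"
  by (rule order_automorphismI[of _ _ "translate (inv c)"])
    (use assms in \<open>simp_all add: partial_order_X translate_mono translate_mult translate_one\<close>)

section \<open>Every automorphism is a right translation\<close>

lemma equivariant_eq_translation:
  assumes p: "\<And>a. a \<in> carrier G \<Longrightarrow> p a \<in> carrier G"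
    and eq: "\<And>k a. k \<in> {1..n} \<Longrightarrow> a \<in> carrier G \<Longrightarrow> p (s k \<otimes> a) = s k \<otimes> p a"
    and a: "a \<in> carrier G"
  shows "p a = a \<otimes> p \<one>"
proof -
  \<comment> \<open>The elements whose left multiplication commutes with \<open>p\<close> form a
    subgroup containing the generators, hence everything; evaluating at the identity then determines
    \<open>p\<close>.\<close>
  have "h \<in> carrier G \<and> (\<forall>a\<in>carrier G. p (h \<otimes> a) = h \<otimes> p a)" if "h \<in> generate G (s ` {1..n})" for h
    using that
  proof (induction rule: generate.induct)
    case (inv h)
    then obtain k where k: "k \<in> {1..n}" "h = s k"
      by blast
    have h: "h \<in> carrier G"
      using k s_carrier by blast
    have "p (inv h \<otimes> a) = inv h \<otimes> p a" if a: "a \<in> carrier G" for a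
    proof -
      have "p a = h \<otimes> p (inv h \<otimes> a)"
        using eq[OF k(1), of "inv h \<otimes> a"] k(2) h a by (simp flip: m_assoc)
      then show ?thesis
        using h a p by (simp add: inv_solve_left)
    qed
    then show ?case
      using h by simp
  qed (use eq s_carrier p in \<open>auto simp: m_assoc\<close>)
  then have "p (a \<otimes> \<one>) = a \<otimes> p \<one>"
    using a unfolding generated by blast
  then show ?thesis
    using a by simp
qed

text \<open>The index is \<open>0\<close> for vertices and lies in \<open>{1..n}\<close>,
  \<open>{n+1..2*n}\<close> or \<open>{2*n+1..3*n}\<close> for edge, start and end blocks, so it
  fixes the kind and the colour.\<close>

lemma block_index_determines_kind:
  assumes "i \<in> I" "j \<in> I" "block_index n i = block_index n j"
  shows "(\<exists>a b. a \<in> carrier G \<and> b \<in> carrier G \<and> i = VertexBlock a \<and> j = VertexBlock b) \<or>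
    (\<exists>T k a b. T \<in> {EdgeBlock, StartBlock, EndBlock} \<and> a \<in> carrier G \<and> b \<in> carrier G \<and>
       i = T (k, a, s k \<otimes> a) \<and> j = T (k, b, s k \<otimes> b))"
  using assms(1)
proof (cases rule: X_blocks_cases)
  case (Vertex a)
  from assms(2) show ?thesis
    by (cases rule: X_blocks_cases) (use Vertex assms(3) in auto)
next
  case (Edge k a)
  from assms(2) show ?thesis
    by (cases rule: X_blocks_cases) (use Edge assms(3) in auto)
next
  case (Start k a)
  from assms(2) show ?thesis
    by (cases rule: X_blocks_cases) (use Start assms(3) in auto)
next
  case (End k a)
  from assms(2) show ?thesis
    by (cases rule: X_blocks_cases) (use End assms(3) in auto)
qed

lemma block_automorphism_is_translation:
  assumes \<pi>: "\<And>i. i \<in> I \<Longrightarrow> \<pi> i \<in> I"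
    and idx: "\<And>i. i \<in> I \<Longrightarrow> block_index n (\<pi> i) = block_index n i"
    and conn: "\<And>i j. (i, j) \<in> C \<Longrightarrow> (\<pi> i, \<pi> j) \<in> C"
  shows "\<exists>c\<in>carrier G. \<forall>i\<in>I. \<pi> i = translate_block c i"
proof -
  have "\<exists>b\<in>carrier G. \<pi> (VertexBlock a) = VertexBlock b" if "a \<in> carrier G" for a
    using block_index_determines_kind[OF _ \<pi>, of "VertexBlock a" "VertexBlock a"] that idx
    by (auto simp: X_blocks_iff)
  then obtain p where p: "\<And>a. a \<in> carrier G \<Longrightarrow> p a \<in> carrier G"
      "\<And>a. a \<in> carrier G \<Longrightarrow> \<pi> (VertexBlock a) = VertexBlock (p a)"
    by metis
  have edge: "\<pi> (EdgeBlock (k, a, s k \<otimes> a)) = EdgeBlock (k, p a, s k \<otimes> p a) \<and>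
      \<pi> (StartBlock (k, a, s k \<otimes> a)) = StartBlock (k, p a, s k \<otimes> p a) \<and>
      \<pi> (EndBlock (k, a, s k \<otimes> a)) = EndBlock (k, p a, s k \<otimes> p a) \<and>
      p (s k \<otimes> a) = s k \<otimes> p a"
    if ka: "k \<in> {1..n}" "a \<in> carrier G" for k a
  proof -
    let ?e = "(k, a, s k \<otimes> a)"
    have sa: "s k \<otimes> a \<in> carrier G"
      using s_carrier ka by simp
    have blocks: "EdgeBlock ?e \<in> I" "StartBlock ?e \<in> I" "EndBlock ?e \<in> I"
      using ka by (simp_all add: X_blocks_iff)
    have cs: "(EdgeBlock ?e, StartBlock ?e) \<in> C" "(VertexBlock a, StartBlock ?e) \<in> C"
        "(EdgeBlock ?e, EndBlock ?e) \<in> C" "(VertexBlock (s k \<otimes> a), EndBlock ?e) \<in> C"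
      using ka by (auto simp: X_connections_iff)
    obtain b where b: "\<pi> (EdgeBlock ?e) = EdgeBlock (k, b, s k \<otimes> b)"
      using block_index_determines_kind[OF blocks(1) \<pi>[OF blocks(1)]] idx[OF blocks(1)] by auto
    obtain b' where b': "\<pi> (StartBlock ?e) = StartBlock (k, b', s k \<otimes> b')"
      using block_index_determines_kind[OF blocks(2) \<pi>[OF blocks(2)]] idx[OF blocks(2)] by auto
    obtain b'' where b'': "\<pi> (EndBlock ?e) = EndBlock (k, b'', s k \<otimes> b'')"
      using block_index_determines_kind[OF blocks(3) \<pi>[OF blocks(3)]] idx[OF blocks(3)] by auto
    show ?thesis
      \<comment> \<open>The connections from the edge block force \<open>b = b' = b''\<close>. The
        one from the starting vertex gives \<open>b' = p a\<close>, and the one from the end vertex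
        then reads \<open>p (s k \<otimes> a) = s k \<otimes> p a\<close>.\<close>
      using conn[OF cs(1)] conn[OF cs(2)] conn[OF cs(3)] conn[OF cs(4)] p(2)[OF ka(2)] p(2)[OF sa]
      by (auto simp: b b' b'' X_connections_iff)
  qed
  have trans: "p a = a \<otimes> p \<one>" if "a \<in> carrier G" for a
    using equivariant_eq_translation[of p a] p(1) edge that by blast
  have "\<pi> i = translate_block (p \<one>) i" if "i \<in> I" for i
    using that
  proof (cases rule: X_blocks_cases)
    case (Vertex a)
    then show ?thesis using p(2) trans[of a] by simp
  next
    case (Edge k a)
    then show ?thesis using edge[of k a] trans[of a] p(1) s_carrier by (simp add: m_assoc)
  next
    case (Start k a)
    then show ?thesis using edge[of k a] trans[of a] p(1) s_carrier by (simp add: m_assoc)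
  next
    case (End k a)
    then show ?thesis using edge[of k a] trans[of a] p(1) s_carrier by (simp add: m_assoc)
  qed
  then show ?thesis
    using p(1) one_closed by blast
qed

lemma automorphism_is_translation:
  assumes f: "order_automorphism X f"
  shows "\<exists>c\<in>carrier G. \<forall>p\<in>Field X. f p = translate c p"
proof -
  obtain \<pi> where \<pi>: "\<And>i. i \<in> I \<Longrightarrow> \<pi> i \<in> I"
    and fst_f: "\<And>i x. i \<in> I \<Longrightarrow> x \<in> Field (B i) \<Longrightarrow> fst (f (i, x)) = \<pi> i"
    and bij: "\<And>i. i \<in> I \<Longrightarrow> bij_betw (\<lambda>x. snd (f (i, x))) (Field (B i)) (Field (B (\<pi> i)))"
    and le: "\<And>i x y. i \<in> I \<Longrightarrow> x \<in> Field (B i) \<Longrightarrow> y \<in> Field (B i) \<Longrightarrow>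
           (snd (f (i, x)), snd (f (i, y))) \<in> B (\<pi> i) \<longleftrightarrow> (x, y) \<in> B i"
    and conn: "\<And>i j. i \<in> I \<Longrightarrow> j \<in> I \<Longrightarrow> (\<pi> i, \<pi> j) \<in> C \<longleftrightarrow> (i, j) \<in> C"
    by (rule automorphism_block_map[OF f]) (rule that)
  have idx: "block_index n (\<pi> i) = block_index n i" if "i \<in> I" for i
    using bij_betw_same_card[OF bij[OF that]] by (simp add: is_F_global(3)[OF F])
  \<comment> \<open>Equal indices mean that block \<open>i\<close> and its image are the same poset,
    so \<open>f\<close> restricts to an automorphism of it and rigidity applies.\<close>
  have snd_f: "snd (f (i, x)) = x" if "i \<in> I" "x \<in> Field (B i)" for i x
    using bij[OF that(1)] le[OF that(1)] idx[OF that(1)] that(2)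
    by (intro is_F_rigid[OF F, of "block_index n i" "\<lambda>x. snd (f (i, x))"])
      (auto simp: order_automorphism_def)
  obtain c where "c \<in> carrier G" "\<And>i. i \<in> I \<Longrightarrow> \<pi> i = translate_block c i"
    using block_automorphism_is_translation[of \<pi>] \<pi> idx conn X_connections_blocks by blast
  then have "f (i, x) = translate c (i, x)" if "i \<in> I" "x \<in> Field (B i)" for i x
    using that fst_f snd_f by (simp add: translate_def prod_eq_iff)
  then have "\<forall>p\<in>Field X. f p = translate c p"
    by (auto simp: Field_S)
  with \<open>c \<in> carrier G\<close> show ?thesis
    by blast
qed

section \<open>The isomorphism with \<open>G\<close>\<close>

lemma self_equivalence_group_X_space: "self_equivalence_group (X_space F G n s) \<cong> G"
proof -
  define T where "T = X_space F G n s"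
  define E where "E = self_equivalence_group T"
  \<comment> \<open>The inverse undoes the order reversal in \<open>translate_mult\<close>, turning
    an anti-homomorphism into a homomorphism.\<close>
  define \<Phi> where "\<Phi> g = homotopy_rel T `` {translate (inv g)}" for g
  have T: "T = poset_topology X"
    by (simp add: T_def X_space_def)
  note beat = partial_order_X finite_X no_down_beat_point_S no_down_beat_point_converse_S
  have equiv_iff: "homotopy_equivalence_map T T f \<longleftrightarrow> order_automorphism X f" for f
    unfolding T using beat by (rule homotopy_equivalence_map_beat_free)
  have cont: "continuous_map T T (translate c)" if "c \<in> carrier G" for c
    using order_automorphism_translate[OF that] equiv_iff by (auto simp: homotopy_equivalence_map_def)
  have class_eq: "homotopy_rel T `` {f} = homotopy_rel T `` {g} \<longleftrightarrow> (\<forall>p\<in>Field X. f p = g p)"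
    if "order_automorphism X f" "order_automorphism X g" for f g
  proof -
    have "continuous_map T T f" "continuous_map T T g"
      using that equiv_iff by (auto simp: homotopy_equivalence_map_def)
    then have "homotopy_rel T `` {f} = homotopy_rel T `` {g} \<longleftrightarrow> (f, g) \<in> homotopy_rel T"
      using eq_equiv_class_iff[OF equiv_homotopy_rel] by auto
    then show ?thesis
      using homotopic_automorphism_iff[OF beat that] by (simp add: homotopy_rel_def T)
  qed
  have "\<Phi> \<in> iso G E"
  proof (rule isoI)
    have carrier_E: "carrier E = (\<lambda>f. homotopy_rel T `` {f}) ` {f. order_automorphism X f}"
      by (auto simp: E_def self_equivalence_group_def quotient_def equiv_iff)
    show "\<Phi> \<in> hom G E"
    proof (rule homI)
      show "\<Phi> g \<in> carrier E" if "g \<in> carrier G" for g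
        using that order_automorphism_translate by (auto simp: \<Phi>_def carrier_E)
      show "\<Phi> (g \<otimes> h) = \<Phi> g \<otimes>\<^bsub>E\<^esub> \<Phi> h" if gh: "g \<in> carrier G" "h \<in> carrier G" for g h
      proof -
        have "\<Phi> g \<otimes>\<^bsub>E\<^esub> \<Phi> h = homotopy_rel T `` {translate (inv g) \<circ> translate (inv h)}"
          unfolding E_def \<Phi>_def using gh by (intro mult_self_equivalence_group cont) auto
        moreover have "order_automorphism X (translate (inv g) \<circ> translate (inv h))"
          using homotopy_equivalence_map_comp[of T] equiv_iff order_automorphism_translate gh by simp
        ultimately show ?thesis
          unfolding \<Phi>_def using class_eq order_automorphism_translate gh
          by (simp add: translate_mult inv_mult_group)
      qed
    qed
    show "bij_betw \<Phi> (carrier G) (carrier E)"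
      unfolding bij_betw_def
    proof (intro conjI inj_onI subset_antisym subsetI)
      fix g h assume gh: "g \<in> carrier G" "h \<in> carrier G" "\<Phi> g = \<Phi> h"
      then have eq: "\<forall>p\<in>Field X. translate (inv g) p = translate (inv h) p"
        using class_eq order_automorphism_translate by (simp add: \<Phi>_def)
      \<comment> \<open>A point in the vertex block of the identity is sent to the vertex block of
        the translating element, so the translation determines that element.\<close>
      obtain x where "x \<in> Field (F 0)"
        using is_F_global(3)[OF F[of 0]] by fastforce
      then have "(VertexBlock \<one>, x) \<in> Field X"
        by (simp add: Field_S X_blocks_iff)
      then have "inv g = inv h"
        using eq gh by (force simp: translate_def)
      then show "g = h"
        using gh inv_inj by (simp add: inj_on_eq_iff)
    next
      fix A assume "A \<in> carrier E"
      then obtain f where f: "order_automorphism X f" "A = homotopy_rel T `` {f}"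
        by (auto simp: carrier_E)
      then obtain c where c: "c \<in> carrier G" "\<forall>p\<in>Field X. f p = translate c p"
        using automorphism_is_translation by blast
      then have "A = \<Phi> (inv c)"
        using f class_eq order_automorphism_translate by (simp add: \<Phi>_def)
      then show "A \<in> \<Phi> ` carrier G"
        using c by auto
    qed (use order_automorphism_translate in \<open>auto simp: \<Phi>_def carrier_E\<close>)
  qed
  then show ?thesis
    unfolding E_def T_def by (blast intro: iso_sym is_isoI)
qed

end

theorem theorem2p11:
  fixes G :: "('g, 'm) monoid_scheme" and n :: nat and s :: "nat \<Rightarrow> 'g"
    and F :: "nat \<Rightarrow> 'p rel"
  assumes "group G" and "finite (carrier G)"
    and "inj_on s {1..n}" and "s ` {1..n} \<subseteq> carrier G"
    and "generate G (s ` {1..n}) = carrier G"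
    and "\<And>k. is_F k (F k)"
  shows "self_equivalence_group (X_space F G n s) \<cong> G"
proof -
  interpret cayley_space G n s F
    by (intro cayley_space.intro cayley_space_axioms.intro) (use assms in auto)
  show ?thesis
    by (rule self_equivalence_group_X_space)
qed

end
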